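(* Let $\mathbb{F}$ be any field. Let $\lambda_1=(1+n_1,n_2,\dots,n_s)$ and $\lambda_2=(1+m_1,m_2,\dots,m_t)$ be two partitions of $n+1$ of type (I), and let $\mu_1=(1+a_1,a_2,\dots,a_h)$ and $\mu_2=(1+b_1,b_2,\dots,b_k)$ be two partitions of $n+1$ of type (II). Then: (a) $S_{\lambda_1}$ is not conjugate to $S_{\mu_1}^{\sharp}$ in $\mathrm{AGL}_n(\mathbb{F})$; (b) $S_{\lambda_1}$ is conjugate in $\mathrm{AGL}_n(\mathbb{F})$ to $S_{\lambda_2}$ if and only if $\lambda_1=\lambda_2$; (c) $S_{\mu_1}^{\sharp}$ is conjugate in $\mathrm{AGL}_n(\mathbb{F})$ to $S_{\mu_2}^{\sharp}$ if and only if $\mu_1=\mu_2$.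
   Context: $\mathrm{AGL}_n(\mathbb{F})$ denotes the subgroup of $\mathrm{GL}_{n+1}(\mathbb{F})$ consisting of the matrices with first column $(1,0,\dots,0)^{\mathrm T}$. Partitions. A partition of $n+1$ is of type (I) if it is written $(1+n_1,n_2,\dots,n_s)$ with $s\ge 1$ and $n_i\ge n_{i+1}\ge 1$ for $1\le i\le s-1$ (and $n_1\ge 1$). It is of type (II) if it is written $(1+n_1,n_2,\dots,n_s)$ with $s\ge 2$, $1+n_1\ge n_2>1$, and $n_i\ge n_{i+1}\ge 1$ for $2\le i\le s-1$. Toeplitz blocks. For $m\ge 1$ and $u=(u_1,\dots,u_m)\in\mathbb{F}^m$ let $\tau_{1+m}(u)\in\mathrm{GL}_m(\mathbb{F})$ be the upper unitriangular matrix whose $(i,j)$ entry is $1$ if $i=j$, $u_{j-i}$ if $i<j$, and $0$ if $i>j$. Put $S_{(1+m)}=\left\{\begin{pmatrix}1&u\\0&\tau_{1+m}(u)\end{pmatrix}:u\in\mathbb{F}^m\right\}\le \mathrm{AGL}_m(\mathbb{F})$; this is the centralizer in $\mathrm{AGL}_m(\mathbb{F})$ of the unipotent upper triangular Jordan block of size $m+1$. Products. $\mathrm{AGL}_{m_1}(\mathbb{F})\times \mathrm{AGL}_{m_2}(\mathbb{F})$ is identified with the subgroup of $\mathrm{AGL}_{m_1+m_2}(\mathbb{F})$ of all matrices $\begin{pmatrix}1&v&w\\0&A&0\\0&0&B\end{pmatrix}$ with $v\in\mathbb{F}^{m_1}$, $w\in\mathbb{F}^{m_2}$, $A\in\mathrm{GL}_{m_1}(\mathbb{F})$,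 $B\in\mathrm{GL}_{m_2}(\mathbb{F})$, and similarly for more factors. Standard subgroups. For $\lambda=(1+n_1,n_2,\dots,n_s)$ of type (I), $S_\lambda=\prod_{j=1}^s S_{(1+n_j)}\le \mathrm{AGL}_n(\mathbb{F})$. For a partition $(1+n_1,n_2)$ with $1+n_1\ge n_2>1$ set $$S^{\sharp}_{(1+n_1,n_2)}=\left\{\begin{pmatrix}1&u&v\\0&\tau_{1+n_1}(u)&w\otimes Du^{\mathrm T}\\0&0&\tau_{1+n_2}(v)\end{pmatrix}:u\in\mathbb{F}^{n_1},\ v\in\mathbb{F}^{n_2}\right\},$$ where $w=(0,\dots,0,1)\in\mathbb{F}^{n_2}$ and $D=\mathrm{antidiag}(1,\dots,1)\in\mathrm{GL}_{n_1}(\mathbb{F})$; thus $w\otimes Du^{\mathrm T}$ is the $n_1\times n_2$ matrix whose last column is $(u_{n_1},\dots,u_1)^{\mathrm T}$ and whose other columns are zero. For $\mu=(1+n_1,n_2,\dots,n_s)$ of type (II), $S_\mu^{\sharp}=S^{\sharp}_{(1+n_1,n_2)}\times\prod_{j=3}^s S_{(1+n_j)}\le \mathrm{AGL}_n(\mathbb{F})$. *)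

theory Defs
  imports "HOL-Algebra.Coset" "Jordan_Normal_Form.Matrix"
begin

definition GL :: "nat \<Rightarrow> 'a::field mat monoid" where
  "GL n = units_of (ring_mat TYPE('a) n ())"

definition AGL :: "nat \<Rightarrow> 'a::field mat monoid" where
  "AGL n = (GL (n + 1))
     \<lparr>carrier := {A \<in> carrier (GL (n + 1)). col A 0 = unit_vec (n + 1) 0}\<rparr>"

lemma subgroup_AGL: "subgroup (carrier (AGL n)) (GL (n + 1) :: 'a::field mat monoid)"
proof -
  define m where "m = n + 1"
  define G :: "'a mat monoid" where "G = GL m"
  interpret R: ring "ring_mat TYPE('a) m ()" by (rule ring_mat)
  interpret G: group G unfolding G_def GL_def by (rule R.units_group)
  have mem: "A \<in> carrier (AGL n) \<longleftrightarrow> A \<in> carrier G \<and> col A 0 = unit_vec m 0" for A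
    by (simp add: AGL_def G_def m_def)
  have c: "A \<in> carrier_mat m m" if "A \<in> carrier G" for A
    using that by (auto simp: G_def GL_def units_of_def Units_def ring_mat_simps)
  have e: "A *\<^sub>v unit_vec m 0 = col A 0" if "A \<in> carrier G" for A
    using c[OF that] by (intro eq_vecI) (auto simp: m_def)
  have cm: "col (A \<otimes>\<^bsub>G\<^esub> B) 0 = A *\<^sub>v col B 0" if "A \<in> carrier G" "B \<in> carrier G" for A B
    using c[OF that(1)] c[OF that(2)] by (simp add: G_def GL_def units_of_def ring_mat_simps m_def)
  have one: "col \<one>\<^bsub>G\<^esub> 0 = unit_vec m 0"
    by (simp add: G_def GL_def units_of_def ring_mat_simps m_def)
  have "subgroup (carrier (AGL n)) G"
  proof (rule G.subgroupI)
    show "carrier (AGL n) \<subseteq> carrier G" by (auto simp: mem)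
    show "carrier (AGL n :: 'a mat monoid) \<noteq> {}" using one G.one_closed mem by blast
    fix A :: "'a mat" assume A: "A \<in> carrier (AGL n)"
    then have "col (inv\<^bsub>G\<^esub> A) 0 = inv\<^bsub>G\<^esub> A *\<^sub>v col A 0" by (simp add: e mem)
    also have "\<dots> = col (inv\<^bsub>G\<^esub> A \<otimes>\<^bsub>G\<^esub> A) 0" using A cm[of "inv\<^bsub>G\<^esub> A" A] by (simp add: mem del: G.l_inv)
    also have "\<dots> = unit_vec m 0" using A by (simp add: one mem)
    finally show "inv\<^bsub>G\<^esub> A \<in> carrier (AGL n)" using A by (simp add: mem)
    fix B :: "'a mat" assume B: "B \<in> carrier (AGL n)"
    show "A \<otimes>\<^bsub>G\<^esub> B \<in> carrier (AGL n)" using A B by (simp add: mem cm e)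
  qed
  then show ?thesis by (simp add: G_def m_def)
qed

definition conjugate_in :: "('a, 'b) monoid_scheme \<Rightarrow> 'a set \<Rightarrow> 'a set \<Rightarrow> bool" where
  "conjugate_in G H K \<longleftrightarrow> (\<exists>g \<in> carrier G. K = g <#\<^bsub>G\<^esub> H #>\<^bsub>G\<^esub> (inv\<^bsub>G\<^esub> g))"

text \<open>A partition \<open>(1 + n\<^sub>1, n\<^sub>2, \<dots>, n\<^sub>s)\<close> is represented by the list of its parts,
  whose head is \<open>1 + n\<^sub>1\<close> (and not \<open>n\<^sub>1\<close>).\<close>

definition partition_type_I :: "nat \<Rightarrow> nat list \<Rightarrow> bool" where
  "partition_type_I N p \<longleftrightarrow>
     (\<exists>n1 ns. p = (1 + n1) # ns \<and> sorted_wrt (\<ge>) (n1 # ns) \<and>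
        (\<forall>k \<in> set (n1 # ns). k \<ge> 1)) \<and>
     sum_list p = N"

definition partition_type_II :: "nat \<Rightarrow> nat list \<Rightarrow> bool" where
  "partition_type_II N p \<longleftrightarrow>
     (\<exists>n1 n2 ns. p = (1 + n1) # n2 # ns \<and> 1 + n1 \<ge> n2 \<and> n2 > 1 \<and>
        sorted_wrt (\<ge>) (n2 # ns) \<and> (\<forall>k \<in> set ns. k \<ge> 1)) \<and>
     sum_list p = N"

text \<open>The coordinate \<open>u\<^sub>k\<close>, with \<open>k \<ge> 1\<close>, is \<open>u $ (k - 1)\<close>.\<close>

definition toeplitz :: "nat \<Rightarrow> 'a::field vec \<Rightarrow> 'a mat" where
  "toeplitz m u = mat m m (\<lambda>(i, j). if i = j then 1 else if i < j then u $ (j - i - 1) else 0)"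

text \<open>The block matrix with rows \<open>(1, v)\<close> and \<open>(0, A)\<close>.\<close>

definition affine_mat :: "'a::field vec \<Rightarrow> 'a mat \<Rightarrow> 'a mat" where
  "affine_mat v A = four_block_mat (1\<^sub>m 1) (mat_of_row v) (0\<^sub>m (dim_row A) 1) A"

definition S_block :: "nat \<Rightarrow> 'a::field mat set" where
  "S_block m = {affine_mat u (toeplitz m u) | u. u \<in> carrier_vec m}"

text \<open>The image of \<open>G \<times> H\<close>, for \<open>G\<close> in \<open>AGL m1\<close> and \<open>H\<close> in \<open>AGL m2\<close>, under the
  identification of \<open>AGL m1 \<times> AGL m2\<close> with a subgroup of \<open>AGL (m1 + m2)\<close>.\<close>

definition AGL_times :: "nat \<Rightarrow> nat \<Rightarrow> 'a::field mat set \<Rightarrow> 'a mat set \<Rightarrow> 'a mat set" where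
  "AGL_times m1 m2 G H =
     {affine_mat (v @\<^sub>v w) (four_block_mat A (0\<^sub>m m1 m2) (0\<^sub>m m2 m1) B) | v w A B.
        v \<in> carrier_vec m1 \<and> A \<in> carrier_mat m1 m1 \<and> affine_mat v A \<in> G \<and>
        w \<in> carrier_vec m2 \<and> B \<in> carrier_mat m2 m2 \<and> affine_mat w B \<in> H}"

text \<open>The empty product is the trivial group \<open>AGL 0\<close>.\<close>

fun S_prod :: "nat list \<Rightarrow> 'a::field mat set" where
  "S_prod [] = {1\<^sub>m 1}"
| "S_prod (m # ms) = AGL_times m (sum_list ms) (S_block m) (S_prod ms)"

definition antidiag :: "nat \<Rightarrow> 'a::field mat" where
  "antidiag m = mat m m (\<lambda>(i, j). if i + j + 1 = m then 1 else 0)"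

text \<open>The Kronecker product of the row vector \<open>w\<close> with the column vector \<open>x\<close>.\<close>

definition row_tensor_col :: "'a::field vec \<Rightarrow> 'a vec \<Rightarrow> 'a mat" where
  "row_tensor_col w x = mat (dim_vec x) (dim_vec w) (\<lambda>(i, j). w $ j * x $ i)"

definition S_sharp_block :: "nat \<Rightarrow> nat \<Rightarrow> 'a::field mat set" where
  "S_sharp_block n1 n2 =
     {affine_mat (u @\<^sub>v v)
        (four_block_mat (toeplitz n1 u) (row_tensor_col (unit_vec n2 (n2 - 1)) (antidiag n1 *\<^sub>v u))
                        (0\<^sub>m n2 n1)     (toeplitz n2 v)) | u v.
        u \<in> carrier_vec n1 \<and> v \<in> carrier_vec n2}"

text \<open>Only the values on partitions of type I, respectively II, matter.\<close>

fun S_std :: "nat list \<Rightarrow> 'a::field mat set" where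
  "S_std (Suc n1 # ns) = S_prod (n1 # ns)"
| "S_std _ = undefined"

fun S_sharp :: "nat list \<Rightarrow> 'a::field mat set" where
  "S_sharp (Suc n1 # n2 # ns) =
     AGL_times (n1 + n2) (sum_list ns) (S_sharp_block n1 n2) (S_prod ns)"
| "S_sharp _ = undefined"

end

theory Submission
  imports Defs "Jordan_Normal_Form.Determinant"
begin

text \<open>Every group in question has the form \<open>1 + J\<close> with \<open>J\<close> a commutative nilpotent algebra of
  matrices. For \<open>S\<^sub>\<lambda>\<close> this algebra is the direct sum of the algebras \<open>x F[x] / x\<^bsup>m + 1\<^esup>\<close> over
  \<open>m \<in> {n\<^sub>1, \<dots>, n\<^sub>s}\<close>; for the first factor of a sharp group it is spanned by the powers of \<open>x\<close>
  and \<open>y\<close> with \<open>x y = 0\<close> and \<open>x\<^bsup>n1 + 1\<^esup> = y\<^bsup>n2\<^esup>\<close>. Let \<open>d\<^sub>k\<close> be the dimension of the intersection of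
  \<open>J\<^sup>k\<close> with the annihilator of \<open>J\<close>, a conjugacy invariant. Each summand has a one-dimensional
  annihilator, so \<open>d\<^sub>k\<close> counts the parts that are at least \<open>k\<close> in the list \<open>(n\<^sub>1, \<dots>, n\<^sub>s)\<close> for type I
  and \<open>(1 + n\<^sub>1, n\<^sub>3, \<dots>, n\<^sub>s)\<close> for type II. Hence the numbers \<open>d\<^sub>k\<close> determine this list, and the
  missing part \<open>n\<^sub>2\<close> is recovered from \<open>n\<close>. The two lists cannot agree across types, since the first one
  sums to \<open>n\<close> and the second one to \<open>n + 1 - n\<^sub>2 < n\<close>.\<close>

section \<open>Dimension and conjugation of matrix spaces\<close>

text \<open>Dimension \<open>d\<close>: functions on \<open>nat\<close>, of which only the first \<open>d\<close> values matter, stand in for \<open>F\<^sup>d\<close>.\<close>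

definition has_coords :: "nat \<Rightarrow> nat \<Rightarrow> 'a::field mat set \<Rightarrow> bool" where
  "has_coords N d V \<longleftrightarrow> (\<exists>E :: (nat \<Rightarrow> 'a) \<Rightarrow> 'a mat.
     range E = V \<and> (\<forall>f. E f \<in> carrier_mat N N) \<and>
     (\<forall>f g. E (\<lambda>i. f i + g i) = E f + E g) \<and>
     (\<forall>a f. E (\<lambda>i. a * f i) = a \<cdot>\<^sub>m E f) \<and>
     (\<forall>f. E f = 0\<^sub>m N N \<longleftrightarrow> (\<forall>i<d. f i = 0)))"

text \<open>Invariance of dimension through determinants: with \<open>d' < d\<close>, the
  \<open>E'\<close>-coordinates of the images of \<open>d\<close> standard basis vectors admit a
  nontrivial linear relation, against the injectivity of \<open>E\<close> on the first
  \<open>d\<close> coordinates.\<close>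

lemma has_coords_le:
  assumes "has_coords N d V" "has_coords N d' (V :: 'a::field mat set)"
  shows "d \<le> d'"
proof (rule ccontr)
  assume "\<not> d \<le> d'"
  then have dd: "d' < d" by simp
  from assms(1) obtain E :: "(nat \<Rightarrow> 'a) \<Rightarrow> 'a mat" where
    E: "range E = V" "\<And>f g. E (\<lambda>i. f i + g i) = E f + E g"
      "\<And>a f. E (\<lambda>i. a * f i) = a \<cdot>\<^sub>m E f" "\<And>f. E f = 0\<^sub>m N N \<longleftrightarrow> (\<forall>i<d. f i = 0)"
    unfolding has_coords_def by blast
  from assms(2) obtain E' :: "(nat \<Rightarrow> 'a) \<Rightarrow> 'a mat" where
    E': "range E' = V" "\<And>f g. E' (\<lambda>i. f i + g i) = E' f + E' g"
      "\<And>a f. E' (\<lambda>i. a * f i) = a \<cdot>\<^sub>m E' f" "\<And>f. E' f = 0\<^sub>m N N \<longleftrightarrow> (\<forall>i<d'. f i = 0)"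
    unfolding has_coords_def by blast
  define \<delta> :: "nat \<Rightarrow> nat \<Rightarrow> 'a" where "\<delta> i = (\<lambda>x. if x = i then 1 else 0)" for i
  have "\<forall>i. \<exists>h. E (\<delta> i) = E' h" using E(1) E'(1) by (metis rangeE rangeI)
  then obtain h where h: "\<And>i. E (\<delta> i) = E' (h i)" by metis
  \<comment> \<open>Column \<open>i\<close> lists the \<open>E'\<close>-coordinates of
    \<open>E (\<delta> i)\<close>, padded with zeros to a square matrix. Row \<open>d'\<close>
    exists because \<open>d' < d\<close>; it is written as a zero vector so that the determinant
    visibly vanishes.\<close>
  define A where "A = mat\<^sub>r d d (\<lambda>j. if j = d' then 0\<^sub>v d else vec d (\<lambda>i. if j < d' then h i j else 0))"
  have "det A = 0" unfolding A_def by (rule det_row_0[OF dd]) auto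
  moreover have Ac: "A \<in> carrier_mat d d" unfolding A_def by simp
  ultimately obtain v where v: "v \<in> carrier_vec d" "v \<noteq> 0\<^sub>v d" "A *\<^sub>v v = 0\<^sub>v d"
    using det_0_iff_vec_prod_zero_field by blast
  \<comment> \<open>Finite sums are not among the properties of \<open>E\<close> and
    \<open>E'\<close>, so additivity and homogeneity are iterated.\<close>
  have comb: "E (\<lambda>x. \<Sum>i<m. v $ i * \<delta> i x) = E' (\<lambda>x. \<Sum>i<m. v $ i * h i x)" for m
  proof (induction m)
    case 0
    have "E (\<lambda>x. 0) = 0\<^sub>m N N" "E' (\<lambda>x. 0) = 0\<^sub>m N N" using E(4) E'(4) by simp_all
    then show ?case by simp
  next
    case (Suc m)
    then show ?case by (simp add: E(2,3) E'(2,3) h)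
  qed
  have "(\<Sum>i<d. v $ i * h i j) = 0" if "j < d'" for j
  proof -
    have "row A j = vec d (\<lambda>i. h i j)" unfolding A_def using dd that by simp
    then have "0 = vec d (\<lambda>i. h i j) \<bullet> v"
      using v Ac dd that by (metis carrier_matD(1) index_mult_mat_vec index_zero_vec(1) order.strict_trans)
    also have "\<dots> = (\<Sum>i<d. h i j * v $ i)"
      using v by (simp add: scalar_prod_def lessThan_atLeast0)
    finally show ?thesis by (simp add: mult.commute)
  qed
  then have "E' (\<lambda>x. \<Sum>i<d. v $ i * h i x) = 0\<^sub>m N N" using E'(4) by blast
  then have z: "\<forall>x<d. (\<Sum>i<d. v $ i * \<delta> i x) = 0" using comb[of d] E(4) by simp
  have "v $ x = 0" if "x < d" for x
    using z[rule_format, OF that] that by (simp add: \<delta>_def if_distrib cong: if_cong)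
  then show False using v by (auto intro: eq_vecI)
qed

lemma has_coords_unique: "has_coords N d V \<Longrightarrow> has_coords N d' V \<Longrightarrow> d = d'"
  by (meson has_coords_le le_antisym)

lemma has_coords_zero: "has_coords N 0 {0\<^sub>m N N}"
  unfolding has_coords_def by (rule exI[of _ "\<lambda>f. 0\<^sub>m N N"]) auto

lemma has_coords_line:
  assumes "B \<in> carrier_mat N N" "B \<noteq> (0\<^sub>m N N :: 'a::field mat)"
  shows "has_coords N 1 {c \<cdot>\<^sub>m B | c. True}"
proof -
  obtain i j where ij: "i < N" "j < N" "B $$ (i,j) \<noteq> 0"
    using assms by (metis carrier_matD eq_matI index_zero_mat)
  have "(c \<cdot>\<^sub>m B = 0\<^sub>m N N) = (c = 0)" for c
  proof
    assume "c \<cdot>\<^sub>m B = 0\<^sub>m N N"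
    then have "(c \<cdot>\<^sub>m B) $$ (i,j) = 0" using ij by simp
    then show "c = 0" using ij assms by simp
  qed (use assms in auto)
  then have z: "(f 0 \<cdot>\<^sub>m B = 0\<^sub>m N N) = (\<forall>i<1. f i = 0)" for f :: "nat \<Rightarrow> 'a" by simp
  have "range (\<lambda>f :: nat \<Rightarrow> 'a. f 0 \<cdot>\<^sub>m B) = {c \<cdot>\<^sub>m B | c. True}"
    by (auto intro: range_eqI[of _ _ "\<lambda>_. _"])
  then show ?thesis unfolding has_coords_def
    using assms(1) z by (intro exI[of _ "\<lambda>f. f 0 \<cdot>\<^sub>m B"]) (auto simp: algebra_simps)
qed

lemma conj_eq_zero_iff:
  assumes "M \<in> carrier_mat N N" "g \<in> carrier_mat N N" "g' \<in> carrier_mat N N"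
    "g' * g = 1\<^sub>m N" "g * g' = 1\<^sub>m N"
  shows "g * M * g' = 0\<^sub>m N N \<longleftrightarrow> M = (0\<^sub>m N N :: 'a::field mat)"
proof
  assume a: "g * M * g' = 0\<^sub>m N N"
  have "M = (g' * g) * M * (g' * g)" using assms by simp
  also have "\<dots> = g' * (g * M * g') * g" using assms(1-3)
    by (simp add: assoc_mult_mat[where n\<^sub>1=N and n\<^sub>2=N and n\<^sub>3=N and n\<^sub>4=N])
  finally show "M = 0\<^sub>m N N" using a assms by simp
qed (use assms in simp)

text \<open>Conjugation is linear with trivial kernel, so it can be composed with any coordinate
  map.\<close>

lemma has_coords_conj:
  assumes V: "has_coords N d V" and g: "g \<in> carrier_mat N N" "g' \<in> carrier_mat N N" "g' * g = 1\<^sub>m N" "g * g' = 1\<^sub>m N"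
  shows "has_coords N d ((\<lambda>M. g * M * g') ` V)"
proof -
  from V obtain E where
    E: "range E = V" "\<And>f. E f \<in> carrier_mat N N" "\<And>f g. E (\<lambda>i. f i + g i) = E f + E g"
      "\<And>a f. E (\<lambda>i. a * f i) = a \<cdot>\<^sub>m E f" "\<And>f. E f = 0\<^sub>m N N \<longleftrightarrow> (\<forall>i<d. f i = 0)"
    unfolding has_coords_def by blast
  show ?thesis unfolding has_coords_def
  proof (intro exI[of _ "\<lambda>f. g * E f * g'"] conjI allI)
    show "range (\<lambda>f. g * E f * g') = (\<lambda>M. g * M * g') ` V" using E(1) by auto
    show "g * E f * g' \<in> carrier_mat N N" for f
      by (rule mult_carrier_mat[OF mult_carrier_mat[OF g(1) E(2)] g(2)])
  
    show "g * E (\<lambda>i. f i + h i) * g' = g * E f * g' + g * E h * g'" for f h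
      using E(2)[of f] E(2)[of h] g
      by (simp add: E(3) mult_add_distrib_mat[where nr=N and n=N and nc=N] add_mult_distrib_mat[where nr=N and n=N and nc=N])
    show "g * E (\<lambda>i. a * f i) * g' = a \<cdot>\<^sub>m (g * E f * g')" for a f
      using E(2)[of f] g
      by (simp add: E(4) mult_smult_distrib[where nr=N and n=N and nc=N] mult_smult_assoc_mat[where nr=N and n=N and nc=N])
    show "(g * E f * g' = 0\<^sub>m N N) = (\<forall>i<d. f i = 0)" for f using conj_eq_zero_iff[OF E(2) g] E(5) by simp
  qed
qed

text \<open>\<open>mpow J k\<close> consists of products of \<open>k + 1\<close> factors, without taking the span: in the algebras at
  hand every element of \<open>J\<^bsup>k + 1\<^esup>\<close> that matters is a single product.\<close>

fun mpow :: "'a::field mat set \<Rightarrow> nat \<Rightarrow> 'a mat set" where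
  "mpow J 0 = J"
| "mpow J (Suc k) = {A * B | A B. A \<in> mpow J k \<and> B \<in> J}"

text \<open>The index is shifted by one: layer \<open>k\<close> plays the role of the intersection
  of \<open>J^(k+1)\<close> with the two-sided annihilator, so its dimension is the number with
  index \<open>k + 1\<close> in the overview. That it is a linear space at all has to be shown case
  by case.\<close>

definition socle_layer :: "nat \<Rightarrow> 'a::field mat set \<Rightarrow> nat \<Rightarrow> 'a mat set" where
  "socle_layer N J k = {A \<in> mpow J k. \<forall>B\<in>J. A * B = 0\<^sub>m N N \<and> B * A = 0\<^sub>m N N}"

lemma mpow_carrier: "J \<subseteq> carrier_mat N N \<Longrightarrow> mpow J k \<subseteq> carrier_mat N N"
  by (induction k) (auto intro!: mult_carrier_mat)

text \<open>Conjugation is multiplicative and sends only zero to zero, so it carries both the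
  products and the annihilation conditions along.\<close>

lemma socle_layer_conj:
  fixes J :: "'a::field mat set"
  assumes J: "J \<subseteq> carrier_mat N N" and g: "g \<in> carrier_mat N N" "g' \<in> carrier_mat N N" "g' * g = 1\<^sub>m N" "g * g' = 1\<^sub>m N"
  shows "socle_layer N ((\<lambda>M. g * M * g') ` J) k = (\<lambda>M. g * M * g') ` socle_layer N J k"
proof -
  let ?c = "\<lambda>M. g * M * g'"
  have m: "?c A * ?c B = ?c (A * B)" if "A \<in> carrier_mat N N" "B \<in> carrier_mat N N" for A B
  proof -
    have "?c A * ?c B = g * A * (g' * g) * B * g'" using that g(1,2)
      by (simp add: assoc_mult_mat[where n\<^sub>1=N and n\<^sub>2=N and n\<^sub>3=N and n\<^sub>4=N])
    also have "\<dots> = ?c (A * B)" unfolding g(3) using that g(1,2)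
      by (simp add: assoc_mult_mat[where n\<^sub>1=N and n\<^sub>2=N and n\<^sub>3=N and n\<^sub>4=N])
    finally show ?thesis .
  qed
  have p: "mpow (?c ` J) k = ?c ` mpow J k" for k
  proof (induction k)
    case (Suc k)
    have "mpow (?c ` J) (Suc k) = {?c A * ?c B | A B. A \<in> mpow J k \<and> B \<in> J}"
      by (auto simp: Suc)
    also have "\<dots> = {?c (A * B) | A B. A \<in> mpow J k \<and> B \<in> J}"
    proof -
      have "?c A * ?c B = ?c (A * B)" if "A \<in> mpow J k \<and> B \<in> J" for A B
        using m that J mpow_carrier[OF J, of k] by blast
      then show ?thesis by (metis (no_types, lifting))
    qed
    finally show ?case by auto
  qed simp
  have a: "(\<forall>B\<in>J. ?c A * ?c B = 0\<^sub>m N N \<and> ?c B * ?c A = 0\<^sub>m N N) \<longleftrightarrow>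
      (\<forall>B\<in>J. A * B = 0\<^sub>m N N \<and> B * A = 0\<^sub>m N N)" if "A \<in> mpow J k" for A
  proof -
    have A: "A \<in> carrier_mat N N" using mpow_carrier[OF J] that by blast
    have "?c A * ?c B = 0\<^sub>m N N \<longleftrightarrow> A * B = 0\<^sub>m N N"
      "?c B * ?c A = 0\<^sub>m N N \<longleftrightarrow> B * A = 0\<^sub>m N N" if "B \<in> J" for B
    proof -
      have B: "B \<in> carrier_mat N N" using J that by blast
      show "?c A * ?c B = 0\<^sub>m N N \<longleftrightarrow> A * B = 0\<^sub>m N N"
        unfolding m[OF A B] by (rule conj_eq_zero_iff) (use A B g in simp_all)
      show "?c B * ?c A = 0\<^sub>m N N \<longleftrightarrow> B * A = 0\<^sub>m N N"
        unfolding m[OF B A] by (rule conj_eq_zero_iff) (use A B g in simp_all)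
    qed
    then show ?thesis by simp
  qed
  show ?thesis unfolding socle_layer_def p using a by auto
qed

section \<open>Products of affine groups\<close>

text \<open>This is the \<open>J\<close> in \<open>S = 1 + J\<close>. Taking the size from the
  matrix itself avoids a size parameter.\<close>

definition unip_part :: "'a::field mat set \<Rightarrow> 'a mat set" where
  "unip_part S = (\<lambda>M. M - 1\<^sub>m (dim_row M)) ` S"

definition aff_mats :: "nat \<Rightarrow> 'a::field mat set" where
  "aff_mats m = {affine_mat v A | v A. v \<in> carrier_vec m \<and> A \<in> carrier_mat m m}"

text \<open>The shape of \<open>M - 1\<close> for affine \<open>M\<close>. The zero column at index
  0, the only index shared by two factors of a product, keeps the factors from interacting.\<close>

definition aug_mats :: "nat \<Rightarrow> 'a::field mat set" where
  "aug_mats m = {N \<in> carrier_mat (m + 1) (m + 1). \<forall>i\<le>m. N $$ (i, 0) = 0}"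

lemma affine_mat_dim:
  assumes "v \<in> carrier_vec m" "A \<in> carrier_mat m m"
  shows "affine_mat v A \<in> carrier_mat (m + 1) (m + 1)"
  using assms by (auto simp: affine_mat_def)

lemma affine_mat_index:
  assumes "v \<in> carrier_vec m" "A \<in> carrier_mat m m" "i \<le> m" "j \<le> m"
  shows "affine_mat v A $$ (i, j) =
    (if i = 0 then if j = 0 then 1 else v $ (j - 1)
     else if j = 0 then 0 else A $$ (i - 1, j - 1))"
  using assms by (auto simp: affine_mat_def mat_of_row_def index_mat_four_block)

lemma aff_mats_carrier: "aff_mats m \<subseteq> carrier_mat (m + 1) (m + 1)"
  unfolding aff_mats_def using affine_mat_dim by blast

lemma unip_part_aug: "S \<subseteq> aff_mats m \<Longrightarrow> unip_part S \<subseteq> aug_mats m"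
proof
  fix N :: "'a mat" assume S: "S \<subseteq> aff_mats m" and "N \<in> unip_part S"
  then obtain v A where N: "N = affine_mat v A - 1\<^sub>m (dim_row (affine_mat v A))"
    and vA: "v \<in> carrier_vec m" "A \<in> carrier_mat m m"
    unfolding unip_part_def aff_mats_def by blast
  show "N \<in> aug_mats m"
    using affine_mat_dim[OF vA] affine_mat_index[OF vA] unfolding N aug_mats_def by auto
qed

lemma mult_aug:
  assumes "A \<in> carrier_mat (m + 1) (m + 1)" "B \<in> aug_mats m"
  shows "A * B \<in> aug_mats m"
  using assms unfolding aug_mats_def by (auto simp: scalar_prod_def)

lemma mpow_aug: "J \<subseteq> aug_mats m \<Longrightarrow> mpow J k \<subseteq> aug_mats m"
proof (induction k)
  case (Suc k)
  then have "A * B \<in> aug_mats m" if "A \<in> mpow J k" "B \<in> J" for A B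
    using that by (intro mult_aug) (auto simp: aug_mats_def)
  then show ?case by auto
qed simp

section \<open>Direct sums of algebras glued along the index 0\<close>

definition wedge :: "nat \<Rightarrow> nat \<Rightarrow> 'a::field mat \<Rightarrow> 'a mat \<Rightarrow> 'a mat" where
  "wedge m1 m2 A B = mat (m1 + m2 + 1) (m1 + m2 + 1) (\<lambda>(i, j).
     if i \<le> m1 \<and> j \<le> m1 then A $$ (i, j)
     else if i = 0 then B $$ (0, j - m1)
     else if m1 < i \<and> m1 < j then B $$ (i - m1, j - m1) else 0)"

lemma wedge_carrier: "wedge m1 m2 A B \<in> carrier_mat (m1 + m2 + 1) (m1 + m2 + 1)"
  by (simp add: wedge_def)

text \<open>Indices \<open>1..m1\<close> belong to \<open>A\<close>, later ones to \<open>B\<close>,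
  and only row 0 is common. A path from one block to the other would have to return to index 0,
  which the zero first columns forbid.\<close>

lemma wedge_mult:
  assumes A: "A \<in> aug_mats m1" "A' \<in> aug_mats m1" and B: "B \<in> aug_mats m2" "B' \<in> aug_mats m2"
  shows "wedge m1 m2 A B * wedge m1 m2 A' B' = wedge m1 m2 (A * A') (B * B')"
proof (rule eq_matI)
  fix i j assume "i < dim_row (wedge m1 m2 (A * A') (B * B'))" "j < dim_col (wedge m1 m2 (A * A') (B * B'))"
  then have ij: "i < m1 + m2 + 1" "j < m1 + m2 + 1" by (simp_all add: wedge_def)
  let ?t = "\<lambda>k. wedge m1 m2 A B $$ (i, k) * wedge m1 m2 A' B' $$ (k, j)"
  note dims = A[unfolded aug_mats_def] B[unfolded aug_mats_def]
  have "(wedge m1 m2 A B * wedge m1 m2 A' B') $$ (i, j) = sum ?t {0..<m1 + m2 + 1}"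
    using ij by (simp add: scalar_prod_def wedge_def)
  \<comment> \<open>The summation index is split at \<open>m1\<close>; shifted down by
    \<open>m1\<close>, the second half runs over the indices \<open>1..m2\<close> of
    \<open>B\<close>.\<close>
  also have "{0..<m1 + m2 + 1} = {0..<m1 + 1} \<union> {m1 + 1..<m1 + m2 + 1}" by auto
  also have "sum ?t \<dots> = sum ?t {0..<m1 + 1} + sum ?t {m1 + 1..<m1 + m2 + 1}"
    by (rule sum.union_disjoint) auto
  also have "sum ?t {m1 + 1..<m1 + m2 + 1} = (\<Sum>k = 1..<m2 + 1. ?t (k + m1))"
    using sum.shift_bounds_nat_ivl[of ?t 1 m1 "m2 + 1"] by (simp add: add_ac)
  also have "sum ?t {0..<m1 + 1} = (if i \<le> m1 \<and> j \<le> m1 then (A * A') $$ (i, j) else 0)"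
  proof -
    have "?t k = (if i \<le> m1 \<and> j \<le> m1 then A $$ (i, k) * A' $$ (k, j) else 0)" if "k < m1 + 1" for k
      using that ij dims by (auto simp: wedge_def)
    then have "sum ?t {0..<m1 + 1} = (\<Sum>k = 0..<m1 + 1. if i \<le> m1 \<and> j \<le> m1 then A $$ (i, k) * A' $$ (k, j) else 0)"
      by (intro sum.cong) auto
    then show ?thesis using dims by (auto simp: scalar_prod_def)
  qed
  also have "(\<Sum>k = 1..<m2 + 1. ?t (k + m1)) =
    (if (i = 0 \<or> m1 < i) \<and> m1 < j then (B * B') $$ (i - m1, j - m1) else 0)"
  proof -
    \<comment> \<open>The product of the \<open>B\<close> matrices also has a summand at index 0,
      absent from the shifted range; it vanishes because the first column of \<open>B\<close>
      does.\<close>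
    have "(B * B') $$ (i', j') = (\<Sum>k = 1..<m2 + 1. B $$ (i', k) * B' $$ (k, j'))"
      if "i' \<le> m2" "j' \<le> m2" for i' j'
    proof -
      have "(B * B') $$ (i', j') = (\<Sum>k = 0..<m2 + 1. B $$ (i', k) * B' $$ (k, j'))"
        using that dims by (auto simp: scalar_prod_def)
      also have "\<dots> = B $$ (i', 0) * B' $$ (0, j') + (\<Sum>k = Suc 0..<m2 + 1. B $$ (i', k) * B' $$ (k, j'))"
        by (rule sum.atLeast_Suc_lessThan) simp
      finally show ?thesis using that dims by simp
    qed
    then have p: "(\<Sum>k = 1..<m2 + 1. B $$ (i - m1, k) * B' $$ (k, j - m1)) = (B * B') $$ (i - m1, j - m1)"
      using ij by simp
    have "?t (k + m1) = (if (i = 0 \<or> m1 < i) \<and> m1 < j then B $$ (i - m1, k) * B' $$ (k, j - m1) else 0)"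
      if "k \<in> {1..<m2 + 1}" for k
      using that ij by (auto simp: wedge_def)
    then have "(\<Sum>k = 1..<m2 + 1. ?t (k + m1)) = (\<Sum>k = 1..<m2 + 1.
        if (i = 0 \<or> m1 < i) \<and> m1 < j then B $$ (i - m1, k) * B' $$ (k, j - m1) else 0)"
      by (intro sum.cong) auto
    then show ?thesis using p by auto
  qed
  finally show "(wedge m1 m2 A B * wedge m1 m2 A' B') $$ (i, j) = wedge m1 m2 (A * A') (B * B') $$ (i, j)"
    using ij by (auto simp: wedge_def)
qed (simp_all add: wedge_def)

text \<open>Column 0 of \<open>B\<close> leaves no trace in the wedge; its vanishing comes from
  \<open>aug_mats\<close>.\<close>

lemma wedge_eq_zero_iff:
  assumes A: "A \<in> aug_mats m1" and B: "B \<in> aug_mats m2"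
  shows "wedge m1 m2 A B = 0\<^sub>m (m1 + m2 + 1) (m1 + m2 + 1) \<longleftrightarrow>
    A = 0\<^sub>m (m1 + 1) (m1 + 1) \<and> B = 0\<^sub>m (m2 + 1) (m2 + 1)" (is "?L \<longleftrightarrow> ?R")
proof
  assume ?L
  then have z: "wedge m1 m2 A B $$ (i, j) = 0" if "i < m1 + m2 + 1" "j < m1 + m2 + 1" for i j
    using that by simp
  have "A $$ (i, j) = 0" if "i \<le> m1" "j \<le> m1" for i j
    using z[of i j] that by (simp add: wedge_def)
  moreover have "B $$ (i, j) = 0" if ij: "i \<le> m2" "j \<le> m2" for i j
  proof (cases "j = 0")
    case True
    then show ?thesis using B ij by (simp add: aug_mats_def)
  next
    case False
    then show ?thesis using z[of 0 "j + m1"] z[of "i + m1" "j + m1"] ij by (cases "i = 0") (auto simp: wedge_def)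
  qed
  ultimately show ?R using A B by (auto simp: aug_mats_def)
next
  assume ?R
  then show ?L by (auto simp: wedge_def)
qed

definition wedge_sets :: "nat \<Rightarrow> nat \<Rightarrow> 'a::field mat set \<Rightarrow> 'a mat set \<Rightarrow> 'a mat set" where
  "wedge_sets m1 m2 U V = {wedge m1 m2 A B | A B. A \<in> U \<and> B \<in> V}"

text \<open>The factors in the two components can be chosen independently, so this holds for sets of
  products without passing to spans.\<close>

lemma mpow_wedge_sets:
  assumes "J1 \<subseteq> aug_mats m1" "J2 \<subseteq> aug_mats m2"
  shows "mpow (wedge_sets m1 m2 J1 J2) k = wedge_sets m1 m2 (mpow J1 k) (mpow J2 k)"
proof (induction k)
  case (Suc k)
  have w: "wedge m1 m2 A B * wedge m1 m2 A' B' = wedge m1 m2 (A * A') (B * B')"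
    if "A \<in> mpow J1 k" "B \<in> mpow J2 k" "A' \<in> J1" "B' \<in> J2" for A A' B B'
    using that assms mpow_aug by (intro wedge_mult) blast+
  show ?case
  proof (intro equalityI subsetI)
    fix M assume "M \<in> mpow (wedge_sets m1 m2 J1 J2) (Suc k)"
    then obtain A B A' B' where "M = wedge m1 m2 A B * wedge m1 m2 A' B'"
      and AB: "A \<in> mpow J1 k" "B \<in> mpow J2 k" "A' \<in> J1" "B' \<in> J2"
      unfolding mpow.simps Suc unfolding wedge_sets_def by blast
    then have "M = wedge m1 m2 (A * A') (B * B')" using w by simp
    then show "M \<in> wedge_sets m1 m2 (mpow J1 (Suc k)) (mpow J2 (Suc k))"
      unfolding wedge_sets_def mpow.simps using AB by blast
  next
    fix M assume "M \<in> wedge_sets m1 m2 (mpow J1 (Suc k)) (mpow J2 (Suc k))"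
    then obtain A B A' B' where M: "M = wedge m1 m2 (A * A') (B * B')"
      and AB: "A \<in> mpow J1 k" "B \<in> mpow J2 k" "A' \<in> J1" "B' \<in> J2"
      by (auto simp: wedge_sets_def)
    then show "M \<in> mpow (wedge_sets m1 m2 J1 J2) (Suc k)"
      unfolding M w[OF AB, symmetric] mpow.simps Suc unfolding wedge_sets_def using AB by blast
  qed
qed simp

text \<open>Annihilation is checked in each component. Nonemptiness of both sets is what lets a
  condition over all pairs split into one condition per component.\<close>

lemma socle_layer_wedge_sets:
  assumes J: "J1 \<subseteq> aug_mats m1" "J2 \<subseteq> aug_mats m2" and ne: "J1 \<noteq> {}" "J2 \<noteq> {}"
  shows "socle_layer (m1 + m2 + 1) (wedge_sets m1 m2 J1 J2) k =
    wedge_sets m1 m2 (socle_layer (m1 + 1) J1 k) (socle_layer (m2 + 1) J2 k)"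
proof -
  have w: "wedge m1 m2 A B * wedge m1 m2 A' B' = 0\<^sub>m (m1 + m2 + 1) (m1 + m2 + 1) \<longleftrightarrow> A * A' = 0\<^sub>m (m1 + 1) (m1 + 1) \<and> B * B' = 0\<^sub>m (m2 + 1) (m2 + 1)"
    if a: "A \<in> aug_mats m1" "A' \<in> aug_mats m1" "B \<in> aug_mats m2" "B' \<in> aug_mats m2" for A A' B B' :: "'a mat"
  proof -
    have "A * A' \<in> aug_mats m1" "B * B' \<in> aug_mats m2"
      using a mult_aug by (auto simp: aug_mats_def)
    then show ?thesis unfolding wedge_mult[OF a] by (rule wedge_eq_zero_iff)
  qed
  have ann: "(\<forall>C\<in>wedge_sets m1 m2 J1 J2. wedge m1 m2 A B * C = 0\<^sub>m (m1 + m2 + 1) (m1 + m2 + 1) \<and> C * wedge m1 m2 A B = 0\<^sub>m (m1 + m2 + 1) (m1 + m2 + 1)) \<longleftrightarrow>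
     (\<forall>A'\<in>J1. A * A' = 0\<^sub>m (m1 + 1) (m1 + 1) \<and> A' * A = 0\<^sub>m (m1 + 1) (m1 + 1)) \<and> (\<forall>B'\<in>J2. B * B' = 0\<^sub>m (m2 + 1) (m2 + 1) \<and> B' * B = 0\<^sub>m (m2 + 1) (m2 + 1))"
    if "A \<in> mpow J1 k" "B \<in> mpow J2 k" for A B
  proof -
    have AB: "A \<in> aug_mats m1" "B \<in> aug_mats m2" using that J mpow_aug by blast+
    have "(\<forall>C\<in>wedge_sets m1 m2 J1 J2. wedge m1 m2 A B * C = 0\<^sub>m (m1 + m2 + 1) (m1 + m2 + 1) \<and> C * wedge m1 m2 A B = 0\<^sub>m (m1 + m2 + 1) (m1 + m2 + 1)) \<longleftrightarrow>
       (\<forall>A'\<in>J1. \<forall>B'\<in>J2. wedge m1 m2 A B * wedge m1 m2 A' B' = 0\<^sub>m (m1 + m2 + 1) (m1 + m2 + 1) \<and> wedge m1 m2 A' B' * wedge m1 m2 A B = 0\<^sub>m (m1 + m2 + 1) (m1 + m2 + 1))"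
      unfolding wedge_sets_def by blast
    also have "\<dots> \<longleftrightarrow> (\<forall>A'\<in>J1. \<forall>B'\<in>J2.
        (A * A' = 0\<^sub>m (m1 + 1) (m1 + 1) \<and> B * B' = 0\<^sub>m (m2 + 1) (m2 + 1)) \<and> (A' * A = 0\<^sub>m (m1 + 1) (m1 + 1) \<and> B' * B = 0\<^sub>m (m2 + 1) (m2 + 1)))"
      using J by (intro ball_cong refl arg_cong2[of _ _ _ _ "(\<and>)"] w AB) auto
    also have "\<dots> \<longleftrightarrow> (\<forall>A'\<in>J1. A * A' = 0\<^sub>m (m1 + 1) (m1 + 1) \<and> A' * A = 0\<^sub>m (m1 + 1) (m1 + 1)) \<and> (\<forall>B'\<in>J2. B * B' = 0\<^sub>m (m2 + 1) (m2 + 1) \<and> B' * B = 0\<^sub>m (m2 + 1) (m2 + 1))"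
      using ne by blast
    finally show ?thesis .
  qed
  show ?thesis
  proof (intro equalityI subsetI)
    fix M assume M: "M \<in> socle_layer (m1 + m2 + 1) (wedge_sets m1 m2 J1 J2) k"
    then obtain A B where AB: "M = wedge m1 m2 A B" "A \<in> mpow J1 k" "B \<in> mpow J2 k"
      unfolding socle_layer_def mpow_wedge_sets[OF J] unfolding wedge_sets_def by blast
    moreover have "\<forall>C\<in>wedge_sets m1 m2 J1 J2. M * C = 0\<^sub>m (m1 + m2 + 1) (m1 + m2 + 1) \<and> C * M = 0\<^sub>m (m1 + m2 + 1) (m1 + m2 + 1)"
      using M by (simp add: socle_layer_def)
    ultimately have "A \<in> socle_layer (m1 + 1) J1 k" "B \<in> socle_layer (m2 + 1) J2 k"
      using ann[OF AB(2,3)] by (simp_all add: socle_layer_def)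
    then show "M \<in> wedge_sets m1 m2 (socle_layer (m1 + 1) J1 k) (socle_layer (m2 + 1) J2 k)"
      unfolding AB(1) wedge_sets_def by blast
  next
    fix M assume "M \<in> wedge_sets m1 m2 (socle_layer (m1 + 1) J1 k) (socle_layer (m2 + 1) J2 k)"
    then obtain A B where "M = wedge m1 m2 A B" and AB: "A \<in> mpow J1 k" "B \<in> mpow J2 k"
      and "\<forall>A'\<in>J1. A * A' = 0\<^sub>m (m1 + 1) (m1 + 1) \<and> A' * A = 0\<^sub>m (m1 + 1) (m1 + 1)" "\<forall>B'\<in>J2. B * B' = 0\<^sub>m (m2 + 1) (m2 + 1) \<and> B' * B = 0\<^sub>m (m2 + 1) (m2 + 1)"
      unfolding socle_layer_def wedge_sets_def by blast
    moreover from AB have "wedge m1 m2 A B \<in> wedge_sets m1 m2 (mpow J1 k) (mpow J2 k)"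
      unfolding wedge_sets_def by blast
    ultimately show "M \<in> socle_layer (m1 + m2 + 1) (wedge_sets m1 m2 J1 J2) k"
      using ann[OF AB] unfolding socle_layer_def mpow_wedge_sets[OF J] by blast
  qed
qed

text \<open>The first \<open>d1\<close> coordinates parametrize the first component, the next
  \<open>d2\<close>, shifted down by \<open>d1\<close>, the second.\<close>

lemma has_coords_wedge_sets:
  fixes V1 V2 :: "'a::field mat set"
  assumes V: "has_coords (m1 + 1) d1 V1" "has_coords (m2 + 1) d2 V2"
    and aug: "V1 \<subseteq> aug_mats m1" "V2 \<subseteq> aug_mats m2"
  shows "has_coords (m1 + m2 + 1) (d1 + d2) (wedge_sets m1 m2 V1 V2)"
proof -
  from V(1) obtain E1 :: "(nat \<Rightarrow> 'a) \<Rightarrow> 'a mat" where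
    E1: "range E1 = V1" "\<And>f. E1 f \<in> carrier_mat (m1 + 1) (m1 + 1)" "\<And>f g. E1 (\<lambda>i. f i + g i) = E1 f + E1 g"
      "\<And>a f. E1 (\<lambda>i. a * f i) = a \<cdot>\<^sub>m E1 f" "\<And>f. E1 f = 0\<^sub>m (m1 + 1) (m1 + 1) \<longleftrightarrow> (\<forall>i<d1. f i = 0)"
    unfolding has_coords_def by blast
  from V(2) obtain E2 :: "(nat \<Rightarrow> 'a) \<Rightarrow> 'a mat" where
    E2: "range E2 = V2" "\<And>f. E2 f \<in> carrier_mat (m2 + 1) (m2 + 1)" "\<And>f g. E2 (\<lambda>i. f i + g i) = E2 f + E2 g"
      "\<And>a f. E2 (\<lambda>i. a * f i) = a \<cdot>\<^sub>m E2 f" "\<And>f. E2 f = 0\<^sub>m (m2 + 1) (m2 + 1) \<longleftrightarrow> (\<forall>i<d2. f i = 0)"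
    unfolding has_coords_def by blast
  let ?E = "\<lambda>f. wedge m1 m2 (E1 f) (E2 (\<lambda>i. f (i + d1)))"
  have d1: "dim_row (E1 f) = m1 + 1" "dim_col (E1 f) = m1 + 1" for f using E1(2)[of f] by auto
  have d2: "dim_row (E2 f) = m2 + 1" "dim_col (E2 f) = m2 + 1" for f using E2(2)[of f] by auto
  have E1aug: "E1 f \<in> aug_mats m1" and E2aug: "E2 f \<in> aug_mats m2" for f using E1(1) E2(1) aug by auto
  show ?thesis unfolding has_coords_def
  proof (intro exI[of _ ?E] conjI allI)
    show "range ?E = wedge_sets m1 m2 V1 V2"
    proof (intro equalityI subsetI)
      fix M assume "M \<in> wedge_sets m1 m2 V1 V2"
      then obtain f g where M: "M = wedge m1 m2 (E1 f) (E2 g)"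
        unfolding wedge_sets_def E1(1)[symmetric] E2(1)[symmetric] by blast
      \<comment> \<open>\<open>h\<close> follows \<open>f\<close> below \<open>d1\<close> and
        \<open>g\<close> from there on. Changing \<open>f\<close> beyond \<open>d1\<close> does not
        affect \<open>E1\<close>, since \<open>E1\<close> kills the difference.\<close>
      define h where "h i = (if i < d1 then f i else g (i - d1))" for i
      have "E1 (\<lambda>i. f i + (h i - f i)) = E1 f + E1 (\<lambda>i. h i - f i)" by (rule E1(3))
      moreover have "E1 (\<lambda>i. h i - f i) = 0\<^sub>m (m1 + 1) (m1 + 1)" unfolding E1(5) by (simp add: h_def)
      ultimately have "E1 h = E1 f" using E1(2)[of f] by simp
      then have "M = ?E h" unfolding M by (simp add: h_def)
      then show "M \<in> range ?E" by blast
    qed (use E1(1) E2(1) in \<open>auto simp: wedge_sets_def\<close>)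
    show "?E f \<in> carrier_mat (m1 + m2 + 1) (m1 + m2 + 1)" for f by (rule wedge_carrier)
    show "?E (\<lambda>i. f i + g i) = ?E f + ?E g" for f g
      unfolding E1(3) E2(3) by (rule eq_matI) (simp_all add: wedge_def d1 d2 less_diff_conv2)
    show "?E (\<lambda>i. a * f i) = a \<cdot>\<^sub>m ?E f" for a f
      unfolding E1(4) E2(4) by (rule eq_matI) (simp_all add: wedge_def d1 d2 less_diff_conv2)
    show "?E f = 0\<^sub>m (m1 + m2 + 1) (m1 + m2 + 1) \<longleftrightarrow> (\<forall>i<d1 + d2. f i = 0)" for f
    proof -
      have "(\<forall>i<d1 + d2. f i = 0) \<longleftrightarrow> (\<forall>i<d1. f i = 0) \<and> (\<forall>i<d2. f (i + d1) = 0)"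
      proof (intro iffI conjI allI impI)
        fix i assume a: "(\<forall>i<d1. f i = 0) \<and> (\<forall>i<d2. f (i + d1) = 0)" "i < d1 + d2"
        show "f i = 0" using a spec[of _ "i - d1", OF conjunct2[OF a(1)]] by (cases "i < d1") auto
      qed auto
      then show ?thesis unfolding wedge_eq_zero_iff[OF E1aug E2aug] E1(5) E2(5) by simp
    qed
  qed
qed

text \<open>This links the product of affine groups to the gluing of nilpotent parts.\<close>

lemma affine_mat_direct_sum:
  assumes "v \<in> carrier_vec m1" "A \<in> carrier_mat m1 m1" "w \<in> carrier_vec m2" "B \<in> carrier_mat m2 m2"
  shows "affine_mat (v @\<^sub>v w) (four_block_mat A (0\<^sub>m m1 m2) (0\<^sub>m m2 m1) B) - 1\<^sub>m (m1 + m2 + 1) =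
    wedge m1 m2 (affine_mat v A - 1\<^sub>m (m1 + 1)) (affine_mat w B - 1\<^sub>m (m2 + 1))" (is "?M - _ = _")
proof (rule eq_matI)
  let ?F = "four_block_mat A (0\<^sub>m m1 m2) (0\<^sub>m m2 m1) B"
  have c: "v @\<^sub>v w \<in> carrier_vec (m1 + m2)" "?F \<in> carrier_mat (m1 + m2) (m1 + m2)" using assms by auto
  fix i j assume "i < dim_row (wedge m1 m2 (affine_mat v A - 1\<^sub>m (m1 + 1)) (affine_mat w B - 1\<^sub>m (m2 + 1)))"
    "j < dim_col (wedge m1 m2 (affine_mat v A - 1\<^sub>m (m1 + 1)) (affine_mat w B - 1\<^sub>m (m2 + 1)))"
  then have ij: "i \<le> m1 + m2" "j \<le> m1 + m2" by (simp_all add: wedge_def)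
  have "(?M - 1\<^sub>m (m1 + m2 + 1)) $$ (i, j) = ?M $$ (i, j) - (if i = j then 1 else 0)"
    using affine_mat_dim[OF c] ij by simp
  then show "(?M - 1\<^sub>m (m1 + m2 + 1)) $$ (i, j) =
      wedge m1 m2 (affine_mat v A - 1\<^sub>m (m1 + 1)) (affine_mat w B - 1\<^sub>m (m2 + 1)) $$ (i, j)"
    using assms ij affine_mat_dim[OF assms(1,2)] affine_mat_dim[OF assms(3,4)]
    by (auto simp: wedge_def affine_mat_index[OF c] affine_mat_index[OF assms(1,2)]
        affine_mat_index[OF assms(3,4)] index_mat_four_block)
qed (use assms in \<open>auto simp: wedge_def affine_mat_def\<close>)

lemma AGL_times_aff: "AGL_times m1 m2 G H \<subseteq> aff_mats (m1 + m2)"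
proof
  fix M :: "'a mat" assume "M \<in> AGL_times m1 m2 G H"
  then obtain v w A B where M: "M = affine_mat (v @\<^sub>v w) (four_block_mat A (0\<^sub>m m1 m2) (0\<^sub>m m2 m1) B)"
    and c: "v \<in> carrier_vec m1" "A \<in> carrier_mat m1 m1" "w \<in> carrier_vec m2" "B \<in> carrier_mat m2 m2"
    unfolding AGL_times_def by blast
  show "M \<in> aff_mats (m1 + m2)" unfolding M aff_mats_def using c
    by (auto intro!: exI[of _ "v @\<^sub>v w"] exI[of _ "four_block_mat A (0\<^sub>m m1 m2) (0\<^sub>m m2 m1) B"])
qed

lemma unip_part_AGL_times:
  assumes "G \<subseteq> aff_mats m1" "H \<subseteq> aff_mats m2"
  shows "unip_part (AGL_times m1 m2 G H) = wedge_sets m1 m2 (unip_part G) (unip_part H)"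
proof (intro equalityI subsetI)
  fix N assume "N \<in> unip_part (AGL_times m1 m2 G H)"
  then obtain v w A B
    where N: "N = affine_mat (v @\<^sub>v w) (four_block_mat A (0\<^sub>m m1 m2) (0\<^sub>m m2 m1) B) - 1\<^sub>m (m1 + m2 + 1)"
      and c: "v \<in> carrier_vec m1" "A \<in> carrier_mat m1 m1" "w \<in> carrier_vec m2" "B \<in> carrier_mat m2 m2"
      and m: "affine_mat v A \<in> G" "affine_mat w B \<in> H"
    unfolding unip_part_def AGL_times_def by (auto simp: affine_mat_def)
  have "affine_mat v A - 1\<^sub>m (m1 + 1) \<in> unip_part G" "affine_mat w B - 1\<^sub>m (m2 + 1) \<in> unip_part H"
    unfolding unip_part_def using m affine_mat_dim[OF c(1,2)] affine_mat_dim[OF c(3,4)] by force+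
  then show "N \<in> wedge_sets m1 m2 (unip_part G) (unip_part H)"
    unfolding N affine_mat_direct_sum[OF c] wedge_sets_def by blast
next
  fix N assume "N \<in> wedge_sets m1 m2 (unip_part G) (unip_part H)"
  then obtain P Q where N: "N = wedge m1 m2 (P - 1\<^sub>m (dim_row P)) (Q - 1\<^sub>m (dim_row Q))"
    and PQ: "P \<in> G" "Q \<in> H" unfolding wedge_sets_def unip_part_def by blast
  obtain v A where P: "P = affine_mat v A" and c: "v \<in> carrier_vec m1" "A \<in> carrier_mat m1 m1"
    using PQ assms unfolding aff_mats_def by blast
  obtain w B where Q: "Q = affine_mat w B" and c': "w \<in> carrier_vec m2" "B \<in> carrier_mat m2 m2"
    using PQ assms unfolding aff_mats_def by blast
  let ?M = "affine_mat (v @\<^sub>v w) (four_block_mat A (0\<^sub>m m1 m2) (0\<^sub>m m2 m1) B)"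
  have "N = ?M - 1\<^sub>m (m1 + m2 + 1)"
    unfolding affine_mat_direct_sum[OF c c'] N P Q
    using affine_mat_dim[OF c] affine_mat_dim[OF c'] by simp
  moreover have "dim_row ?M = m1 + m2 + 1" using c c' by (simp add: affine_mat_def)
  moreover have "?M \<in> AGL_times m1 m2 G H"
    unfolding AGL_times_def using c c' PQ P Q by blast
  ultimately show "N \<in> unip_part (AGL_times m1 m2 G H)" unfolding unip_part_def by force
qed

text \<open>Layer dimensions add over the factors of a product, which reduces everything to single
  blocks.\<close>

lemma socle_coords_AGL_times:
  assumes G: "G \<subseteq> aff_mats m1" "G \<noteq> {}" and H: "H \<subseteq> aff_mats m2" "H \<noteq> {}"
    and "has_coords (m1 + 1) d1 (socle_layer (m1 + 1) (unip_part G) k)"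
    and "has_coords (m2 + 1) d2 (socle_layer (m2 + 1) (unip_part H) k)"
  shows "has_coords (m1 + m2 + 1) (d1 + d2)
    (socle_layer (m1 + m2 + 1) (unip_part (AGL_times m1 m2 G H)) k)"
proof -
  have J: "unip_part G \<subseteq> aug_mats m1" "unip_part H \<subseteq> aug_mats m2" using unip_part_aug G H by auto
  have ne: "unip_part G \<noteq> {}" "unip_part H \<noteq> {}" using G H by (auto simp: unip_part_def)
  have "socle_layer (m1 + 1) (unip_part G) k \<subseteq> aug_mats m1" "socle_layer (m2 + 1) (unip_part H) k \<subseteq> aug_mats m2"
    using mpow_aug[OF J(1), of k] mpow_aug[OF J(2), of k] by (auto simp: socle_layer_def)
  then show ?thesis
    unfolding unip_part_AGL_times[OF G(1) H(1)] socle_layer_wedge_sets[OF J ne]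
    using has_coords_wedge_sets assms(5,6) by blast
qed

section \<open>Algebras with a one-dimensional annihilator\<close>

text \<open>The generators used below are sparse; this and its row version turn multiplication by
  them into a shift of columns or rows.\<close>

lemma mult_single_col:
  fixes A :: "'a::field mat"
  assumes "A \<in> carrier_mat N N" "P \<in> carrier_mat N N" "i < N" "j < N" "l < N"
    and "\<And>k. k < N \<Longrightarrow> k \<noteq> l \<Longrightarrow> P $$ (k, j) = 0"
  shows "(A * P) $$ (i, j) = A $$ (i, l) * P $$ (l, j)"
proof -
  have "(A * P) $$ (i, j) = (\<Sum>k\<in>{0..<N}. A $$ (i, k) * P $$ (k, j))"
    using assms by (simp add: scalar_prod_def)
  also have "\<dots> = (\<Sum>k\<in>{l}. A $$ (i, k) * P $$ (k, j))"
    using assms by (intro sum.mono_neutral_right) auto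
  finally show ?thesis by simp
qed

lemma mult_single_row:
  fixes A :: "'a::field mat"
  assumes "A \<in> carrier_mat N N" "P \<in> carrier_mat N N" "i < N" "j < N" "l < N"
    and "\<And>k. k < N \<Longrightarrow> k \<noteq> l \<Longrightarrow> P $$ (i, k) = 0"
  shows "(P * A) $$ (i, j) = P $$ (i, l) * A $$ (l, j)"
proof -
  have "(P * A) $$ (i, j) = (\<Sum>k\<in>{0..<N}. P $$ (i, k) * A $$ (k, j))"
    using assms by (simp add: scalar_prod_def)
  also have "\<dots> = (\<Sum>k\<in>{l}. P $$ (i, k) * A $$ (k, j))"
    using assms by (intro sum.mono_neutral_right) auto
  finally show ?thesis by simp
qed

section \<open>Nilpotency through a weight filtration\<close>

definition raises :: "nat \<Rightarrow> (nat \<Rightarrow> nat) \<Rightarrow> nat \<Rightarrow> 'a::field mat \<Rightarrow> bool" where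
  "raises N wt a A \<longleftrightarrow> (\<forall>i<N. \<forall>j<N. A $$ (i, j) \<noteq> 0 \<longrightarrow> wt i + a \<le> wt j)"

text \<open>A nonzero entry of the product has a nonzero summand, along which the weight climbs by
  \<open>a\<close> and then by \<open>b\<close>.\<close>

lemma raises_mult:
  assumes A: "A \<in> carrier_mat N N" "raises N wt a A" and B: "B \<in> carrier_mat N N" "raises N wt b B"
  shows "raises N wt (a + b) (A * B)"
  unfolding raises_def
proof (intro allI impI)
  fix i j assume ij: "i < N" "j < N" and nz: "(A * B) $$ (i, j) \<noteq> 0"
  have "(A * B) $$ (i, j) = (\<Sum>k\<in>{0..<N}. A $$ (i, k) * B $$ (k, j))"
    using A B ij by (simp add: scalar_prod_def)
  with nz obtain k where "k < N" "A $$ (i, k) * B $$ (k, j) \<noteq> 0"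
    by (metis (no_types, lifting) atLeastLessThan_iff sum.neutral)
  then have "wt i + a \<le> wt k" "wt k + b \<le> wt j" using A B ij unfolding raises_def by auto
  then show "wt i + (a + b) \<le> wt j" by simp
qed

lemma raises_eq_zero:
  assumes "A \<in> carrier_mat N N" "raises N wt a A" "\<And>j. j < N \<Longrightarrow> wt j < a"
  shows "A = 0\<^sub>m N N"
proof (rule eq_matI)
  fix i j assume "i < dim_row (0\<^sub>m N N)" "j < dim_col (0\<^sub>m N N)"
  then have ij: "i < N" "j < N" by simp_all
  with assms(2,3) have "A $$ (i, j) = 0" unfolding raises_def by (meson add_leD2 not_le)
  then show "A $$ (i, j) = 0\<^sub>m N N $$ (i, j)" using ij by simp
qed (use assms(1) in auto)

lemma raises_mpow:
  assumes "J \<subseteq> carrier_mat N N" "\<And>A. A \<in> J \<Longrightarrow> raises N wt 1 A" "A \<in> mpow J k"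
  shows "raises N wt (k + 1) A"
  using assms(3)
proof (induction k arbitrary: A)
  case (Suc k)
  then obtain B C where "A = B * C" "B \<in> mpow J k" "C \<in> J" by auto
  then show ?case
    using raises_mult[of B N wt "k + 1" C 1] Suc.IH[of B] assms(1,2) mpow_carrier[OF assms(1), of k] by auto
qed (use assms(2) in simp)

text \<open>The matrix \<open>X i c\<close> plays the role of \<open>c x\<^bsup>i + 1\<^esup>\<close>; \<open>x\<^sup>K\<close> spans the annihilator.\<close>

lemma socle_layer_line:
  fixes J :: "'a::field mat set"
  assumes J: "J \<subseteq> carrier_mat N N"
    and wt: "\<And>A. A \<in> J \<Longrightarrow> raises N wt 1 A" "\<And>j. j < N \<Longrightarrow> wt j \<le> K"
    and X: "\<And>i c. i < K \<Longrightarrow> X i c \<in> J" "\<And>i c. i + 1 < K \<Longrightarrow> X i c * X 0 1 = X (i + 1) c"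
    and K: "0 < K" "\<And>c. X (K - 1) c = c \<cdot>\<^sub>m E"
    and E: "E \<in> carrier_mat N N" "E \<noteq> 0\<^sub>m N N"
    and ann: "\<And>A. A \<in> carrier_mat N N \<Longrightarrow> \<forall>B\<in>J. A * B = 0\<^sub>m N N \<and> B * A = 0\<^sub>m N N \<Longrightarrow> \<exists>c. A = c \<cdot>\<^sub>m E"
  shows "has_coords N (if k < K then 1 else 0) (socle_layer N J k)"
proof (cases "k < K")
  case True
  \<comment> \<open>Splitting off \<open>X 0 1\<close> repeatedly, \<open>l\<close> times, exhibits
    \<open>X i c\<close> as a product of \<open>l + 1\<close> factors.\<close>
  have pw: "X i c \<in> mpow J l" if "l \<le> i" "i < K" for i l c
    using that
  proof (induction l arbitrary: i)
    case (Suc l)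
    then obtain i' where i: "i = i' + 1" by (metis Suc_eq_plus1 Suc_le_D)
    then have "X i c = X i' c * X 0 1" "X i' c \<in> mpow J l" "X 0 1 \<in> J"
      using X(2)[of i' c] X(1)[of 0 1] K(1) Suc by auto
    then show ?case by auto
  qed (use X in simp)
  \<comment> \<open>\<open>X (K - 1) c\<close> is a product of \<open>K\<close> factors from
    \<open>J\<close>, each raising the weight by 1. One more factor on either side would exceed the
    maximal weight \<open>K\<close>, so multiples of \<open>E\<close> annihilate
    \<open>J\<close>.\<close>
  have r: "raises N wt K (c \<cdot>\<^sub>m E)" for c
    using raises_mpow[OF J wt(1) pw[of "K - 1" "K - 1" c]] K by simp
  have "(c \<cdot>\<^sub>m E) * B = 0\<^sub>m N N \<and> B * (c \<cdot>\<^sub>m E) = 0\<^sub>m N N" if B: "B \<in> J" for B c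
  proof -
    have Bc: "B \<in> carrier_mat N N" using B J by blast
    have Ec: "c \<cdot>\<^sub>m E \<in> carrier_mat N N" using E by simp
    have w: "wt j < K + 1" "wt j < 1 + K" if "j < N" for j using wt(2)[OF that] by simp_all
    show ?thesis
      using raises_eq_zero[OF mult_carrier_mat[OF Ec Bc] raises_mult[OF Ec r Bc wt(1)[OF B]] w(1)]
        raises_eq_zero[OF mult_carrier_mat[OF Bc Ec] raises_mult[OF Bc wt(1)[OF B] Ec r] w(2)] by blast
  qed
  moreover have "c \<cdot>\<^sub>m E \<in> mpow J k" for c using pw[of k "K - 1" c] K True by simp
  ultimately have "socle_layer N J k = {c \<cdot>\<^sub>m E | c. True}"
    unfolding socle_layer_def using ann mpow_carrier[OF J, of k] by blast
  then show ?thesis using True has_coords_line[OF E] by simp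
next
  case False
  \<comment> \<open>The zero matrix must itself be a product of \<open>k + 1\<close> elements of
    \<open>J\<close>; it lies in \<open>J\<close> as the case \<open>c = 0\<close>.\<close>
  have "0\<^sub>m N N = X (K - 1) 0" unfolding K(2) using E(1) by (intro eq_matI) auto
  then have "0\<^sub>m N N \<in> J" using X(1) K(1) by simp
  then have z: "0\<^sub>m N N \<in> mpow J k"
  proof (induction k)
    case (Suc k)
    then show ?case by (auto intro!: exI[of _ "0\<^sub>m N N"])
  qed simp
  have "A = 0\<^sub>m N N" if A: "A \<in> mpow J k" for A
  proof (rule raises_eq_zero)
    show "A \<in> carrier_mat N N" using A mpow_carrier[OF J] by blast
    show "raises N wt (k + 1) A" by (rule raises_mpow[OF J wt(1) A])
    show "wt j < k + 1" if "j < N" for j using wt(2)[OF that] False by simp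
  qed
  moreover have "0\<^sub>m N N * B = 0\<^sub>m N N \<and> B * 0\<^sub>m N N = 0\<^sub>m N N" if "B \<in> J" for B
    using that J by auto
  ultimately have "socle_layer N J k = {0\<^sub>m N N}"
    unfolding socle_layer_def using z by blast
  then show ?thesis using False has_coords_zero by simp
qed

section \<open>The blocks of type (I)\<close>

definition nil_toeplitz :: "nat \<Rightarrow> (nat \<Rightarrow> 'a::field) \<Rightarrow> 'a mat" where
  "nil_toeplitz m u = mat (m + 1) (m + 1) (\<lambda>(i, j). if i < j then u (j - i - 1) else 0)"

lemma S_block_aff: "S_block m \<subseteq> aff_mats m"
proof -
  have "toeplitz m u \<in> carrier_mat m m" for u :: "'a vec" by (simp add: toeplitz_def)
  then show ?thesis unfolding S_block_def aff_mats_def by blast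
qed

text \<open>The top row \<open>(0, u)\<close> continues the Toeplitz pattern of the lower right
  block, so the whole matrix of size \<open>m + 1\<close> is strictly upper triangular
  Toeplitz.\<close>

lemma unip_part_S_block: "unip_part (S_block m) = range (nil_toeplitz m :: (nat \<Rightarrow> 'a::field) \<Rightarrow> _)"
proof -
  have e: "affine_mat u (toeplitz m u) - 1\<^sub>m (dim_row (affine_mat u (toeplitz m u))) = nil_toeplitz m f"
    if u: "u \<in> carrier_vec m" and f: "\<And>i. i < m \<Longrightarrow> f i = u $ i" for u :: "'a vec" and f
  proof -
    have t: "toeplitz m u \<in> carrier_mat m m" by (simp add: toeplitz_def)
    show ?thesis
      by (rule eq_matI)
        (use affine_mat_dim[OF u t] affine_mat_index[OF u t] f in \<open>auto simp: nil_toeplitz_def toeplitz_def\<close>)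
  qed
  show ?thesis
  proof (intro equalityI subsetI)
    fix N assume "N \<in> unip_part (S_block m :: 'a mat set)"
    then obtain u :: "'a vec" where u: "u \<in> carrier_vec m"
      "N = affine_mat u (toeplitz m u) - 1\<^sub>m (dim_row (affine_mat u (toeplitz m u)))"
      unfolding unip_part_def S_block_def by blast
    have "N = nil_toeplitz m (($) u)" using e[OF u(1)] u(2) by simp
    then show "N \<in> range (nil_toeplitz m)" by simp
  next
    fix N assume "N \<in> range (nil_toeplitz m :: (nat \<Rightarrow> 'a) \<Rightarrow> _)"
    then obtain f :: "nat \<Rightarrow> 'a" where f: "N = nil_toeplitz m f" by blast
    have "N = affine_mat (vec m f) (toeplitz m (vec m f)) - 1\<^sub>m (dim_row (affine_mat (vec m f) (toeplitz m (vec m f))))"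
      unfolding f by (rule e[symmetric]) auto
    then show "N \<in> unip_part (S_block m)" unfolding unip_part_def S_block_def by (intro image_eqI) auto
  qed
qed

text \<open>The top right matrix unit; it will span the annihilator of each block, ordinary or
  sharp.\<close>

definition corner :: "nat \<Rightarrow> 'a::field mat" where
  "corner m = mat (m + 1) (m + 1) (\<lambda>(i, j). if i = 0 \<and> j = m then 1 else 0)"

lemma corner_carrier: "corner m \<in> carrier_mat (m + 1) (m + 1)"
  by (simp add: corner_def)

lemma corner_nonzero: "corner m \<noteq> 0\<^sub>m (m + 1) (m + 1)"
proof
  have "(corner m :: 'a mat) $$ (0, m) \<noteq> 0\<^sub>m (m + 1) (m + 1) $$ (0, m)" by (simp add: corner_def)
  moreover assume "corner m = (0\<^sub>m (m + 1) (m + 1) :: 'a mat)"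
  ultimately show False by metis
qed

lemma eq_corner:
  assumes A: "A \<in> carrier_mat (m + 1) (m + 1)"
    and "\<And>i j. i \<le> m \<Longrightarrow> j < m \<Longrightarrow> A $$ (i, j) = 0" "\<And>i j. 0 < i \<Longrightarrow> i \<le> m \<Longrightarrow> j \<le> m \<Longrightarrow> A $$ (i, j) = 0"
  shows "\<exists>c. A = c \<cdot>\<^sub>m (corner m :: 'a::field mat)"
proof (intro exI[of _ "A $$ (0, m)"] eq_matI)
  fix i j assume "i < dim_row (A $$ (0, m) \<cdot>\<^sub>m (corner m :: 'a mat))" "j < dim_col (A $$ (0, m) \<cdot>\<^sub>m (corner m :: 'a mat))"
  then have "i \<le> m" "j \<le> m" by (simp_all add: corner_def)
  then show "A $$ (i, j) = (A $$ (0, m) \<cdot>\<^sub>m corner m) $$ (i, j)"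
    using assms(2)[of i j] assms(3)[of i j] by (cases "i = 0"; cases "j = m") (auto simp: corner_def)
qed (use A in \<open>auto simp: corner_def\<close>)

text \<open>The algebra consists of the polynomials without constant term in the nilpotent Jordan
  block \<open>X 0 1\<close>, whose last nonzero power is \<open>corner m\<close>. The weight of an
  index is the index itself.\<close>

lemma socle_coords_S_block:
  assumes "0 < m"
  shows "has_coords (m + 1) (if k < m then 1 else 0) (socle_layer (m + 1) (unip_part (S_block m :: 'a::field mat set)) k)"
  unfolding unip_part_S_block
proof (rule socle_layer_line[where wt = "\<lambda>i. i" and E = "corner m"
      and X = "\<lambda>i c. nil_toeplitz m (\<lambda>l. if l = i then c else 0)"])
  let ?X = "\<lambda>i c. nil_toeplitz m (\<lambda>l. if l = i then (c :: 'a) else 0)"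
  have c: "nil_toeplitz m f \<in> carrier_mat (m + 1) (m + 1)" for f :: "nat \<Rightarrow> 'a" by (simp add: nil_toeplitz_def)
  then show "range (nil_toeplitz m :: (nat \<Rightarrow> 'a) \<Rightarrow> _) \<subseteq> carrier_mat (m + 1) (m + 1)" by blast
  show "raises (m + 1) (\<lambda>i. i) 1 A" if "A \<in> range (nil_toeplitz m)" for A :: "'a mat"
  proof -
    obtain f where "A = nil_toeplitz m f" using \<open>A \<in> _\<close> by blast
    then show ?thesis by (simp add: raises_def nil_toeplitz_def)
  qed
  \<comment> \<open>Right multiplication by the Jordan block moves columns to the right, left
    multiplication moves rows up. A matrix killed on both sides therefore lives only in its first
    row and last column.\<close>
  have col: "(A * ?X 0 1) $$ (i, j + 1) = A $$ (i, j)" if "i \<le> m" "j < m" "A \<in> carrier_mat (m + 1) (m + 1)" for A i j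
    using mult_single_col[OF that(3) c, of i "j + 1" j "\<lambda>l. if l = 0 then 1 else 0"] that by (auto simp: nil_toeplitz_def)
  have row: "(?X 0 1 * A) $$ (i, j) = A $$ (i + 1, j)" if "i < m" "j \<le> m" "A \<in> carrier_mat (m + 1) (m + 1)" for A i j
    using mult_single_row[OF that(3) c, of i j "i + 1" "\<lambda>l. if l = 0 then 1 else 0"] that by (auto simp: nil_toeplitz_def)
  have col0: "(A * ?X 0 1) $$ (i, 0) = 0" if "i \<le> m" "A \<in> carrier_mat (m + 1) (m + 1)" for A i
    using mult_single_col[OF that(2) c, of i 0 0 "\<lambda>l. if l = 0 then 1 else 0"] that by (auto simp: nil_toeplitz_def)
  show "?X i c * ?X 0 1 = ?X (i + 1) c" if "i + 1 < m" for i c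
  proof (rule eq_matI)
    fix a b assume "a < dim_row (?X (i + 1) c)" "b < dim_col (?X (i + 1) c)"
    then have ab: "a \<le> m" "b \<le> m" by (simp_all add: nil_toeplitz_def)
    show "(?X i c * ?X 0 1) $$ (a, b) = ?X (i + 1) c $$ (a, b)"
    proof (cases b)
      case 0
      then show ?thesis using col0[OF ab(1) c] ab by (simp add: nil_toeplitz_def)
    next
      case (Suc b')
      have "(?X i c * ?X 0 1) $$ (a, b) = ?X i c $$ (a, b')"
        unfolding Suc Suc_eq_plus1 by (rule col[OF ab(1) _ c]) (use Suc ab in simp)
      then show ?thesis using Suc ab that by (auto simp: nil_toeplitz_def)
    qed
  qed (simp_all add: nil_toeplitz_def)
  show "?X (m - 1) c = c \<cdot>\<^sub>m corner m" for c
    by (rule eq_matI) (use assms in \<open>auto simp: nil_toeplitz_def corner_def\<close>)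
  fix A :: "'a mat" assume A: "A \<in> carrier_mat (m + 1) (m + 1)"
    and z: "\<forall>B\<in>range (nil_toeplitz m). A * B = 0\<^sub>m (m + 1) (m + 1) \<and> B * A = 0\<^sub>m (m + 1) (m + 1)"
  have z1: "A * ?X 0 1 = 0\<^sub>m (m + 1) (m + 1)" "?X 0 1 * A = 0\<^sub>m (m + 1) (m + 1)" using z by blast+
  show "\<exists>c. A = c \<cdot>\<^sub>m corner m"
  proof (rule eq_corner[OF A])
    show "A $$ (i, j) = 0" if "i \<le> m" "j < m" for i j
      using col[OF that A] that unfolding z1 by simp
    show "A $$ (i, j) = 0" if "0 < i" "i \<le> m" "j \<le> m" for i j
      using row[of "i - 1" j, OF _ that(3) A] that unfolding z1 by simp
  qed
qed (use assms corner_carrier corner_nonzero in auto)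

section \<open>The sharp blocks\<close>

definition nil_sharp :: "nat \<Rightarrow> nat \<Rightarrow> (nat \<Rightarrow> 'a::field) \<Rightarrow> (nat \<Rightarrow> 'a) \<Rightarrow> 'a mat" where
  "nil_sharp n1 n2 u v = mat (n1 + n2 + 1) (n1 + n2 + 1) (\<lambda>(i, j).
     if j \<le> n1 then if i < j then u (j - i - 1) else 0
     else if i = 0 then v (j - n1 - 1)
     else if i \<le> n1 then if j = n1 + n2 then u (n1 - i) else 0
     else if i < j then v (j - i - 1) else 0)"

lemma S_sharp_block_aff: "S_sharp_block n1 n2 \<subseteq> aff_mats (n1 + n2)"
proof -
  have "u @\<^sub>v v \<in> carrier_vec (n1 + n2)" if "u \<in> carrier_vec n1" "v \<in> carrier_vec n2" for u v :: "'a vec"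
    using that by simp
  moreover have "four_block_mat (toeplitz n1 u) B (0\<^sub>m n2 n1) (toeplitz n2 v) \<in> carrier_mat (n1 + n2) (n1 + n2)"
    for u v :: "'a vec" and B
    by (simp add: toeplitz_def four_block_carrier_mat)
  ultimately show ?thesis unfolding S_sharp_block_def aff_mats_def by blast
qed

lemma antidiag_mult_index:
  assumes "u \<in> carrier_vec m" "i < m"
  shows "(antidiag m *\<^sub>v u) $ i = (u $ (m - i - 1) :: 'a::field)"
proof -
  have "(antidiag m *\<^sub>v u) $ i = (\<Sum>k\<in>{0..<m}. (if i + k + 1 = m then 1 else 0) * u $ k)"
    using assms by (simp add: antidiag_def scalar_prod_def)
  also have "\<dots> = (\<Sum>k\<in>{m - i - 1}. (if i + k + 1 = m then 1 else 0) * u $ k)"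
    using assms by (intro sum.mono_neutral_right) auto
  finally show ?thesis using assms by simp
qed

text \<open>A comparison of entries. The tensor with \<open>w\<close> puts \<open>u\<close>,
  reversed by the antidiagonal matrix, into rows \<open>1..n1\<close> of the last column of the full
  matrix.\<close>

lemma unip_part_S_sharp_block:
  "unip_part (S_sharp_block n1 n2) = {nil_sharp n1 n2 u v | u v :: nat \<Rightarrow> 'a::field. True}"
proof -
  let ?B = "\<lambda>u v :: 'a vec. four_block_mat (toeplitz n1 u)
    (row_tensor_col (unit_vec n2 (n2 - 1)) (antidiag n1 *\<^sub>v u)) (0\<^sub>m n2 n1) (toeplitz n2 v)"
  let ?M = "\<lambda>u v :: 'a vec. affine_mat (u @\<^sub>v v) (?B u v)"
  have e: "?M u v - 1\<^sub>m (dim_row (?M u v)) = nil_sharp n1 n2 f g"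
    if u: "u \<in> carrier_vec n1" and v: "v \<in> carrier_vec n2"
      and f: "\<And>i. i < n1 \<Longrightarrow> f i = u $ i" and g: "\<And>i. i < n2 \<Longrightarrow> g i = v $ i" for u v f g
  proof -
    define B where "B = ?B u v"
    let ?A = "affine_mat (u @\<^sub>v v) B"
    have c: "u @\<^sub>v v \<in> carrier_vec (n1 + n2)" "B \<in> carrier_mat (n1 + n2) (n1 + n2)"
      using u v by (simp_all add: B_def toeplitz_def four_block_carrier_mat)
    have d: "dim_row ?A = n1 + n2 + 1" "dim_col ?A = n1 + n2 + 1" using affine_mat_dim[OF c] by auto
    \<comment> \<open>\<open>B\<close> omits row and column 0 of the full matrix, so all indices
      here are one lower than in \<open>nil_sharp\<close>; \<open>j + 1 = n1 + n2\<close> is the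
      last column.\<close>
    have b: "B $$ (i, j) = (if i < n1 then if j < n1 then if i = j then 1 else if i < j then u $ (j - i - 1) else 0
          else if j + 1 = n1 + n2 then u $ (n1 - i - 1) else 0
        else if j < n1 then 0 else if i = j then 1 else if i < j then v $ (j - i - 1) else 0)"
      if "i < n1 + n2" "j < n1 + n2" for i j
    proof -
      have "B $$ (i, j) = (if i < n1 then if j < n1 then toeplitz n1 u $$ (i, j)
          else row_tensor_col (unit_vec n2 (n2 - 1)) (antidiag n1 *\<^sub>v u) $$ (i, j - n1)
        else if j < n1 then 0 else toeplitz n2 v $$ (i - n1, j - n1))"
        unfolding B_def using that by (simp add: toeplitz_def)
      moreover have "row_tensor_col (unit_vec n2 (n2 - 1)) (antidiag n1 *\<^sub>v u) $$ (i, j - n1) =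
          (if j + 1 = n1 + n2 then u $ (n1 - i - 1) else 0)" if "i < n1" "\<not> j < n1"
        using that \<open>j < n1 + n2\<close> antidiag_mult_index[OF u that(1)]
        by (auto simp: row_tensor_col_def antidiag_def simp del: index_mult_mat_vec)
      ultimately show ?thesis using that by (auto simp: toeplitz_def)
    qed
    have "?A - 1\<^sub>m (n1 + n2 + 1) = nil_sharp n1 n2 f g"
    proof (rule eq_matI)
      fix i j assume "i < dim_row (nil_sharp n1 n2 f g)" "j < dim_col (nil_sharp n1 n2 f g)"
      then have ij: "i \<le> n1 + n2" "j \<le> n1 + n2" by (simp_all add: nil_sharp_def)
      have "(?A - 1\<^sub>m (n1 + n2 + 1)) $$ (i, j) = ?A $$ (i, j) - (if i = j then 1 else 0)"
        using ij d by simp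
      also have "\<dots> = nil_sharp n1 n2 f g $$ (i, j)"
      proof (cases "i = 0 \<or> j = 0")
        case True
        then show ?thesis unfolding affine_mat_index[OF c ij] using ij u v f g by (auto simp: nil_sharp_def)
      next
        case False
        then obtain i' j' where ij': "i = i' + 1" "j = j' + 1" by (metis Suc_eq_plus1 not0_implies_Suc)
        then have "i' < n1 + n2" "j' < n1 + n2" using ij by simp_all
        note b' = b[OF this]
        have "?A $$ (i, j) = B $$ (i', j')" unfolding affine_mat_index[OF c ij] using ij' by simp
        then show ?thesis
          unfolding b' ij' using ij f g unfolding ij' by (auto simp: nil_sharp_def)
      qed
      finally show "(?A - 1\<^sub>m (n1 + n2 + 1)) $$ (i, j) = nil_sharp n1 n2 f g $$ (i, j)" .
    qed (use d in \<open>simp_all add: nil_sharp_def\<close>)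
    then show ?thesis using d(1) unfolding B_def by simp
  qed
  show ?thesis
  proof (intro equalityI subsetI)
    fix N assume "N \<in> unip_part (S_sharp_block n1 n2 :: 'a mat set)"
    then obtain u v where uv: "u \<in> carrier_vec n1" "v \<in> carrier_vec n2" "N = ?M u v - 1\<^sub>m (dim_row (?M u v))"
      unfolding unip_part_def S_sharp_block_def by blast
    have "N = nil_sharp n1 n2 (($) u) (($) v)" unfolding uv(3) by (rule e[OF uv(1,2)]) simp_all
    then show "N \<in> {nil_sharp n1 n2 u v | u v. True}" by blast
  next
    fix N assume "N \<in> {nil_sharp n1 n2 u v | u v :: nat \<Rightarrow> 'a. True}"
    then obtain f g :: "nat \<Rightarrow> 'a" where N: "N = nil_sharp n1 n2 f g" by blast
    have "N = ?M (vec n1 f) (vec n2 g) - 1\<^sub>m (dim_row (?M (vec n1 f) (vec n2 g)))"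
      unfolding N by (rule e[symmetric]) simp_all
    moreover have "?M (vec n1 f) (vec n2 g) \<in> S_sharp_block n1 n2"
      unfolding S_sharp_block_def using vec_carrier by blast
    ultimately show "N \<in> unip_part (S_sharp_block n1 n2)" unfolding unip_part_def by (rule image_eqI)
  qed
qed

text \<open>In the proof \<open>P\<close> and \<open>Q\<close> are the generators \<open>x\<close> and \<open>y\<close>, and \<open>wt\<close> gives \<open>x\<^sup>i\<close> and \<open>y\<^sup>i\<close> the
  weight \<open>i\<close>, except for \<open>y\<^bsup>n2\<^esup> = x\<^bsup>n1 + 1\<^esup>\<close>, whose weight is \<open>n1 + 1\<close>.\<close>

lemma socle_coords_S_sharp_block:
  assumes n: "0 < n1" "1 < n2" "n2 \<le> n1 + 1"
  shows "has_coords (n1 + n2 + 1) (if k < n1 + 1 then 1 else 0)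
    (socle_layer (n1 + n2 + 1) (unip_part (S_sharp_block n1 n2 :: 'a::field mat set)) k)"
proof -
  define J where "J = {nil_sharp n1 n2 u v | u v :: nat \<Rightarrow> 'a. True}"
  define del :: "nat \<Rightarrow> 'a \<Rightarrow> nat \<Rightarrow> 'a" where "del i c = (\<lambda>l. if l = i then c else 0)" for i c
  define zer :: "nat \<Rightarrow> 'a" where "zer = (\<lambda>l. 0)"
  define P where "P = nil_sharp n1 n2 (del 0 1) zer"
  define Q where "Q = nil_sharp n1 n2 zer (del 0 1)"
  \<comment> \<open>For \<open>i < n1\<close> this is \<open>c\<close> times the power
    \<open>i + 1\<close> of \<open>P\<close>. The top power has no \<open>u\<close>-coordinate left,
    and is written instead as \<open>c\<close> times the power \<open>n2\<close> of
    \<open>Q\<close>, which is the same multiple of the corner.\<close>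
  define X where "X i c = (if i < n1 then nil_sharp n1 n2 (del i c) zer
    else nil_sharp n1 n2 zer (del (n2 - 1) c))" for i c
  define wt where "wt i = (if i \<le> n1 then i else if i < n1 + n2 then i - n1 else n1 + 1)" for i
  let ?N = "n1 + n2 + 1"
  have c: "nil_sharp n1 n2 u v \<in> carrier_mat ?N ?N" for u v :: "nat \<Rightarrow> 'a" by (simp add: nil_sharp_def)
  have Pc: "P \<in> carrier_mat ?N ?N" and Qc: "Q \<in> carrier_mat ?N ?N" unfolding P_def Q_def by (rule c)+
  have X0: "X 0 1 = P" using n by (simp add: X_def P_def)
  have Xi: "X i c $$ (a, b) = (if b = a + i + 1 \<and> b \<le> n1 \<or> b = n1 + n2 \<and> a + i = n1 then c else 0)"
    if "a < ?N" "b < ?N" "i \<le> n1" for i c a b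
  proof (cases "i < n1")
    case True
    then show ?thesis using that n by (auto simp: X_def nil_sharp_def del_def zer_def)
  next
    case False
    then show ?thesis using that n by (auto simp: X_def nil_sharp_def del_def zer_def)
  qed
  have Xc: "X i c \<in> carrier_mat ?N ?N" for i c by (simp add: X_def nil_sharp_def)
  have Pi: "P $$ (i, j) = (if j \<noteq> 0 \<and> j \<le> n1 \<and> i + 1 = j \<or> i = n1 \<and> j = n1 + n2 then 1 else 0)"
    if "i < ?N" "j < ?N" for i j
    using that n by (auto simp: P_def nil_sharp_def del_def zer_def)
  have Qi: "Q $$ (i, j) = (if i = 0 \<and> j = n1 + 1 \<or> n1 < i \<and> i + 1 = j then 1 else 0)"
    if "i < ?N" "j < ?N" for i j
    using that n by (auto simp: Q_def nil_sharp_def del_def zer_def)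
  \<comment> \<open>\<open>P\<close> acts along the chain of indices
    \<open>0, 1, ..., n1, n1 + n2\<close> and \<open>Q\<close> along
    \<open>0, n1 + 1, ..., n1 + n2\<close>. The next four facts read multiplication by them as
    moving one step along these chains.\<close>
  have AP: "(A * P) $$ (i, j) = (if j = 0 then 0 else if j \<le> n1 then A $$ (i, j - 1)
      else if j = n1 + n2 then A $$ (i, n1) else 0)"
    if A: "A \<in> carrier_mat ?N ?N" and ij: "i < ?N" "j < ?N" for A i j
  proof -
    let ?l = "if j \<noteq> 0 \<and> j \<le> n1 then j - 1 else n1"
    have "(A * P) $$ (i, j) = A $$ (i, ?l) * P $$ (?l, j)"
      using ij n by (intro mult_single_col[OF A Pc ij]) (auto simp: Pi)
    then show ?thesis using ij n by (auto simp: Pi)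
  qed
  have AQ: "(A * Q) $$ (i, l + 1) = A $$ (i, l)"
    if A: "A \<in> carrier_mat ?N ?N" and ij: "i < ?N" "n1 < l" "l < n1 + n2" for A i l
  proof -
    have "(A * Q) $$ (i, l + 1) = A $$ (i, l) * Q $$ (l, l + 1)"
      using ij n by (intro mult_single_col[OF A Qc]) (auto simp: Qi)
    then show ?thesis using ij by (simp add: Qi)
  qed
  have PA: "(P * A) $$ (l, j) = A $$ (l + 1, j)"
    if A: "A \<in> carrier_mat ?N ?N" and ij: "j < ?N" "l < n1" for A j l
  proof -
    have "(P * A) $$ (l, j) = P $$ (l, l + 1) * A $$ (l + 1, j)"
      using ij n by (intro mult_single_row[OF A Pc]) (auto simp: Pi)
    then show ?thesis using ij by (simp add: Pi)
  qed
  have QA: "(Q * A) $$ (if l = n1 then 0 else l, j) = A $$ (l + 1, j)"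
    if A: "A \<in> carrier_mat ?N ?N" and ij: "j < ?N" "n1 \<le> l" "l < n1 + n2" for A j l
  proof -
    let ?i = "if l = n1 then 0 else l"
    have "(Q * A) $$ (?i, j) = Q $$ (?i, l + 1) * A $$ (l + 1, j)"
      using ij n by (intro mult_single_row[OF A Qc]) (auto simp: Qi)
    then show ?thesis using ij by (auto simp: Qi)
  qed
  have "has_coords ?N (if k < n1 + 1 then 1 else 0) (socle_layer ?N J k)"
  proof (rule socle_layer_line[where wt = wt and E = "corner (n1 + n2)" and X = X])
    show "J \<subseteq> carrier_mat ?N ?N" using c by (auto simp: J_def)
    show "raises ?N wt 1 A" if A: "A \<in> J" for A
    proof -
      obtain u v where "A = nil_sharp n1 n2 u v" using A by (auto simp: J_def)
      \<comment> \<open>The steps into the last index, of weight \<open>n1 + 1\<close>, come from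
        weights up to \<open>n1\<close> and, on the second chain, up to \<open>n2 - 1\<close>; the
        latter case needs \<open>n2 \<le> n1 + 1\<close>.\<close>
      then show ?thesis using n by (auto simp: raises_def nil_sharp_def wt_def split: if_splits)
    qed
    show "wt j \<le> n1 + 1" if "j < ?N" for j using that n by (auto simp: wt_def)
    show "X i c \<in> J" for i c unfolding X_def J_def by (cases "i < n1") auto
    show "X i c * X 0 1 = X (i + 1) c" if i: "i + 1 < n1 + 1" for i c
      unfolding X0
    proof (rule eq_matI)
      fix a b assume "a < dim_row (X (i + 1) c)" "b < dim_col (X (i + 1) c)"
      then have ab: "a < ?N" "b < ?N" by (simp_all only: carrier_matD[OF Xc])
      show "(X i c * P) $$ (a, b) = X (i + 1) c $$ (a, b)"
        unfolding AP[OF Xc ab] using ab i n by (auto simp: Xi)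
    qed (simp_all only: carrier_matD[OF Xc] carrier_matD[OF Pc] index_mult_mat)
    show "X (n1 + 1 - 1) c = c \<cdot>\<^sub>m corner (n1 + n2)" for c
    proof (rule eq_matI)
      fix a b assume "a < dim_row (c \<cdot>\<^sub>m corner (n1 + n2))" "b < dim_col (c \<cdot>\<^sub>m corner (n1 + n2))"
      then have ab: "a < ?N" "b < ?N" by (simp_all add: corner_def)
      then show "X (n1 + 1 - 1) c $$ (a, b) = (c \<cdot>\<^sub>m corner (n1 + n2)) $$ (a, b)"
        using n by (auto simp: Xi corner_def)
    qed (simp_all only: carrier_matD[OF Xc] carrier_matD[OF corner_carrier] index_smult_mat)
    show "corner (n1 + n2) \<in> carrier_mat ?N ?N" "corner (n1 + n2) \<noteq> 0\<^sub>m ?N ?N" by (rule corner_carrier, rule corner_nonzero)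
    fix A assume A: "A \<in> carrier_mat ?N ?N" and z: "\<forall>B\<in>J. A * B = 0\<^sub>m ?N ?N \<and> B * A = 0\<^sub>m ?N ?N"
    have "P \<in> J" "Q \<in> J" unfolding P_def Q_def J_def by blast+
    with z have z: "A * P = 0\<^sub>m ?N ?N" "P * A = 0\<^sub>m ?N ?N" "A * Q = 0\<^sub>m ?N ?N" "Q * A = 0\<^sub>m ?N ?N" by blast+
    show "\<exists>c. A = c \<cdot>\<^sub>m corner (n1 + n2)"
    proof (rule eq_corner[OF A])
      fix i j assume ij: "i \<le> n1 + n2" "j < n1 + n2"
      \<comment> \<open>Columns before \<open>n1\<close> appear in \<open>A * P\<close> one place to
        the right, column \<open>n1\<close> as its last column, and later columns in
        \<open>A * Q\<close>.\<close>
      consider "j < n1" | "j = n1" | "n1 < j" by linarith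
      then show "A $$ (i, j) = 0"
      proof cases
        case 1
        then show ?thesis using AP[OF A, of i "j + 1"] ij unfolding z by simp
      next
        case 2
        then show ?thesis using AP[OF A, of i "n1 + n2"] ij n unfolding z by simp
      next
        case 3
        then show ?thesis using AQ[OF A, of i j] ij unfolding z by simp
      qed
    next
      fix i j assume ij: "0 < i" "i \<le> n1 + n2" "j \<le> n1 + n2"
      then obtain l where l: "i = l + 1" by (metis Suc_eq_plus1 gr0_implies_Suc)
      show "A $$ (i, j) = 0"
      proof (cases "l < n1")
        case True
        then show ?thesis using PA[OF A, of j l] ij l unfolding z by simp
      next
        case False
        then show ?thesis using QA[OF A, of j l] ij l unfolding z by (simp split: if_splits)
      qed
    qed
  qed simp
  then show ?thesis unfolding unip_part_S_sharp_block J_def .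
qed

section \<open>Conjugacy of the standard subgroups\<close>

lemma S_prod_aff: "S_prod ms \<subseteq> aff_mats (sum_list ms)"
proof (cases ms)
  case Nil
  have "affine_mat (vec 0 f) (1\<^sub>m 0) = 1\<^sub>m 1" for f :: "nat \<Rightarrow> 'a"
    by (rule eq_matI) (auto simp: affine_mat_def mat_of_row_def)
  then have "(1\<^sub>m 1 :: 'a mat) \<in> aff_mats 0"
    unfolding aff_mats_def by (metis (mono_tags, lifting) mem_Collect_eq one_carrier_mat vec_carrier)
  then show ?thesis using Nil by simp
qed (simp add: AGL_times_aff)

lemma AGL_times_ne:
  assumes "G \<subseteq> aff_mats m1" "G \<noteq> {}" "H \<subseteq> aff_mats m2" "H \<noteq> {}"
  shows "AGL_times m1 m2 G H \<noteq> {}"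
proof -
  obtain v A where "affine_mat v A \<in> G" "v \<in> carrier_vec m1" "A \<in> carrier_mat m1 m1"
    using assms(1,2) unfolding aff_mats_def by blast
  moreover obtain w B where "affine_mat w B \<in> H" "w \<in> carrier_vec m2" "B \<in> carrier_mat m2 m2"
    using assms(3,4) unfolding aff_mats_def by blast
  ultimately show ?thesis unfolding AGL_times_def by blast
qed

lemma S_block_ne: "S_block m \<noteq> ({} :: 'a::field mat set)"
  unfolding S_block_def using vec_carrier by blast

lemma S_prod_ne: "S_prod ms \<noteq> ({} :: 'a::field mat set)"
  by (induction ms) (simp_all add: AGL_times_ne S_block_aff S_block_ne S_prod_aff)

text \<open>Each block contributes one dimension as long as \<open>k\<close> is below its part, and
  the trivial group at the end contributes none.\<close>

lemma socle_coords_S_prod: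
  assumes "\<forall>m\<in>set ms. 0 < m"
  shows "has_coords (sum_list ms + 1) (length (filter (\<lambda>m. k < m) ms))
    (socle_layer (sum_list ms + 1) (unip_part (S_prod ms :: 'a::field mat set)) k)"
  using assms
proof (induction ms)
  case Nil
  have u: "unip_part {1\<^sub>m 1 :: 'a mat} = {0\<^sub>m 1 1}" unfolding unip_part_def by auto
  have p: "mpow {0\<^sub>m 1 1 :: 'a mat} k = {0\<^sub>m 1 1}" by (induction k) auto
  have "socle_layer 1 {0\<^sub>m 1 1 :: 'a mat} k = {0\<^sub>m 1 1}" unfolding socle_layer_def p by auto
  then show ?case using has_coords_zero[of 1] u by simp
next
  case (Cons m ms)
  then have h: "has_coords (m + 1) (if k < m then 1 else 0) (socle_layer (m + 1) (unip_part (S_block m :: 'a mat set)) k)"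
    "has_coords (sum_list ms + 1) (length (filter (\<lambda>m. k < m) ms))
      (socle_layer (sum_list ms + 1) (unip_part (S_prod ms :: 'a mat set)) k)"
    using socle_coords_S_block[of m k] by simp_all
  show ?case
    using socle_coords_AGL_times[OF S_block_aff S_block_ne S_prod_aff S_prod_ne h] by (simp split: if_splits)
qed

section \<open>Conjugation inside the affine group\<close>

lemma AGL_ops:
  fixes M M' :: "'a::field mat"
  shows "group (AGL n :: 'a mat monoid)" "M \<otimes>\<^bsub>AGL n\<^esub> M' = M * M'" "\<one>\<^bsub>AGL n\<^esub> = (1\<^sub>m (n + 1) :: 'a mat)"
    "carrier (AGL n :: 'a mat monoid) \<subseteq> carrier_mat (n + 1) (n + 1)"
proof -
  interpret R: ring "ring_mat TYPE('a) (n + 1) ()" by (rule ring_mat)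
  have "group (GL (n + 1) :: 'a mat monoid)" unfolding GL_def by (rule R.units_group)
  then have "group ((GL (n + 1) :: 'a mat monoid) \<lparr>carrier := carrier (AGL n)\<rparr>)"
    by (rule subgroup.subgroup_is_group[OF subgroup_AGL])
  then show "group (AGL n :: 'a mat monoid)" by (simp add: AGL_def)
  show "M \<otimes>\<^bsub>AGL n\<^esub> M' = M * M'" "\<one>\<^bsub>AGL n\<^esub> = (1\<^sub>m (n + 1) :: 'a mat)"
    by (simp_all add: AGL_def GL_def units_of_def ring_mat_simps)
  show "carrier (AGL n :: 'a mat monoid) \<subseteq> carrier_mat (n + 1) (n + 1)"
    by (auto simp: AGL_def GL_def units_of_def Units_def ring_mat_simps)
qed

lemma conjugate_in_AGL_refl:
  assumes "S \<subseteq> aff_mats n"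
  shows "conjugate_in (AGL n) S (S :: 'a::field mat set)"
proof -
  interpret group "AGL n :: 'a mat monoid" by (rule AGL_ops)
  have c: "M \<in> carrier_mat (n + 1) (n + 1)" if "M \<in> S" for M using assms aff_mats_carrier that by blast
  \<comment> \<open>The nested unions of singletons are the unfolded left and right cosets by the
    identity.\<close>
  have "S = (\<Union>h\<in>(\<Union>h\<in>S. {1\<^sub>m (n + 1) * h}). {h * 1\<^sub>m (n + 1)})" using c by force
  then have "S = \<one>\<^bsub>AGL n\<^esub> <#\<^bsub>AGL n\<^esub> S #>\<^bsub>AGL n\<^esub> inv\<^bsub>AGL n\<^esub> \<one>\<^bsub>AGL n\<^esub>"
    unfolding inv_one by (simp add: l_coset_def r_coset_def AGL_ops)
  then show ?thesis unfolding conjugate_in_def using one_closed by blast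
qed

text \<open>Conjugation fixes the identity matrix, hence commutes with \<open>M - 1\<close> and
  conjugates the nilpotent parts.\<close>

lemma socle_coords_conjugate:
  fixes H K :: "'a::field mat set"
  assumes conj: "conjugate_in (AGL n) H K" and H: "H \<subseteq> aff_mats n"
    and "has_coords (n + 1) d (socle_layer (n + 1) (unip_part H) k)"
  shows "has_coords (n + 1) d (socle_layer (n + 1) (unip_part K) k)"
proof -
  interpret group "AGL n :: 'a mat monoid" by (rule AGL_ops)
  obtain g where g: "g \<in> carrier (AGL n)" and K: "K = g <#\<^bsub>AGL n\<^esub> H #>\<^bsub>AGL n\<^esub> inv\<^bsub>AGL n\<^esub> g"
    using conj unfolding conjugate_in_def by blast
  define g' where "g' = inv\<^bsub>AGL n\<^esub> g"
  have gg: "g \<in> carrier_mat (n + 1) (n + 1)" "g' \<in> carrier_mat (n + 1) (n + 1)"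
    "g' * g = 1\<^sub>m (n + 1)" "g * g' = 1\<^sub>m (n + 1)"
    using AGL_ops(4)[of n] g inv_closed[OF g] l_inv[OF g] r_inv[OF g]
    unfolding g'_def AGL_ops(2,3) by blast+
  have K': "K = (\<lambda>M. g * M * g') ` H" unfolding K l_coset_def r_coset_def AGL_ops(2) g'_def by blast
  have "g * M * g' - 1\<^sub>m (dim_row (g * M * g')) = g * (M - 1\<^sub>m (dim_row M)) * g'"
    if "M \<in> H" for M
  proof -
    have M: "M \<in> carrier_mat (n + 1) (n + 1)" using that H aff_mats_carrier by blast
    have "g * (M - 1\<^sub>m (n + 1)) * g' = (g * M - g * 1\<^sub>m (n + 1)) * g'"
      using mult_minus_distrib_mat[OF gg(1) M one_carrier_mat] by simp
    also have "\<dots> = g * M * g' - g * g'"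
      using minus_mult_distrib_mat[OF mult_carrier_mat[OF gg(1) M] gg(1) gg(2)] gg(1) by simp
    finally show ?thesis using M gg by simp
  qed
  then have u: "unip_part K = (\<lambda>M. g * M * g') ` unip_part H"
    unfolding unip_part_def K' image_image by (rule image_cong[OF refl])
  have "unip_part H \<subseteq> carrier_mat (n + 1) (n + 1)"
    using unip_part_aug[OF H] by (auto simp: aug_mats_def)
  then show ?thesis unfolding u using socle_layer_conj[OF _ gg] has_coords_conj[OF assms(3) gg] by simp
qed

section \<open>Recovering the partitions from the layer dimensions\<close>

lemma sorted_eq_if_layer_counts:
  fixes xs ys :: "nat list"
  assumes "sorted_wrt (\<ge>) xs" "sorted_wrt (\<ge>) ys" "\<forall>x\<in>set xs. 0 < x" "\<forall>x\<in>set ys. 0 < x"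
    and eq: "\<And>k. length (filter (\<lambda>x. k < x) xs) = length (filter (\<lambda>x. k < x) ys)"
  shows "xs = ys"
proof -
  \<comment> \<open>Differences of consecutive counts are the multiplicities of the positive values.
    The multiplicity of 0 is invisible to the counts and is settled by positivity.\<close>
  have s: "length (filter (\<lambda>x. k < x) zs) = count (mset zs) (Suc k) + length (filter (\<lambda>x. Suc k < x) zs)" for zs k
    by (induction zs) auto
  have "count (mset xs) x = count (mset ys) x" for x
  proof (cases x)
    case 0
    then show ?thesis using assms(3,4) by (metis count_mset_0_iff less_irrefl)
  next
    case (Suc k)
    then show ?thesis using s[of k xs] s[of k ys] eq[of k] eq[of "Suc k"] by simp
  qed
  then have "mset (rev xs) = mset (rev ys)" by (simp add: multiset_eq_iff)
  moreover have "sorted (rev xs)" "sorted (rev ys)" using assms(1,2) by (simp_all add: sorted_wrt_rev)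
  ultimately have "rev xs = rev ys" by (metis properties_for_sort)
  then show ?thesis by simp
qed

text \<open>The list \<open>p\<close> is the one described in the overview, not the partition: it
  has head \<open>n1\<close> for type (I), and head \<open>1 + n1\<close> with \<open>n2\<close>
  left out for type (II).\<close>

definition layer_counts :: "nat \<Rightarrow> nat list \<Rightarrow> 'a::field mat set \<Rightarrow> bool" where
  "layer_counts n p S \<longleftrightarrow> S \<subseteq> aff_mats n \<and> sorted_wrt (\<ge>) p \<and> (\<forall>x\<in>set p. 0 < x) \<and>
     (\<forall>k. has_coords (n + 1) (length (filter (\<lambda>x. k < x) p)) (socle_layer (n + 1) (unip_part S) k))"

lemma layer_counts_conjugate:
  assumes "layer_counts n p S" "layer_counts n q T" "conjugate_in (AGL n) S (T :: 'a::field mat set)"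
  shows "p = q"
  using assms sorted_eq_if_layer_counts[of p q]
    has_coords_unique[OF socle_coords_conjugate[OF assms(3)]] unfolding layer_counts_def by blast

lemma layer_counts_S_std:
  assumes "partition_type_I (n + 1) lam"
  obtains n1 ns where "lam = Suc n1 # ns" "sum_list (n1 # ns) = n" "layer_counts n (n1 # ns) (S_std lam :: 'a::field mat set)"
proof -
  obtain n1 ns where l: "lam = Suc n1 # ns" "sorted_wrt (\<ge>) (n1 # ns)" "\<forall>k\<in>set (n1 # ns). 1 \<le> k" "sum_list lam = n + 1"
    using assms unfolding partition_type_I_def by auto
  have s: "sum_list (n1 # ns) = n" using l by simp
  have S: "(S_std lam :: 'a mat set) = S_prod (n1 # ns)" using l(1) by simp
  have pos: "\<forall>m\<in>set (n1 # ns). 0 < m" using l(3) by auto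
  have "layer_counts n (n1 # ns) (S_std lam :: 'a mat set)"
    unfolding layer_counts_def S
    using S_prod_aff[of "n1 # ns"] socle_coords_S_prod[OF pos] l(2) pos unfolding s by blast
  then show ?thesis using that l(1) s by blast
qed

text \<open>The sharp block has a one-dimensional annihilator although it uses two parts, so it
  enters the list only through \<open>Suc n1\<close>. The sum is recorded in order to recover
  \<open>n2\<close>.\<close>

lemma layer_counts_S_sharp:
  assumes "partition_type_II (n + 1) mu"
  obtains n1 n2 ns where "mu = Suc n1 # n2 # ns" "1 < n2" "n1 + n2 + sum_list ns = n"
    "layer_counts n (Suc n1 # ns) (S_sharp mu :: 'a::field mat set)"
proof -
  obtain n1 n2 ns where l: "mu = Suc n1 # n2 # ns" "n2 \<le> n1 + 1" "1 < n2" "sorted_wrt (\<ge>) (n2 # ns)"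
      "\<forall>k\<in>set ns. 1 \<le> k" "sum_list mu = n + 1"
    using assms unfolding partition_type_II_def by auto
  have s: "n1 + n2 + sum_list ns = n" and n1: "0 < n1" using l by auto
  have S: "(S_sharp mu :: 'a mat set) = AGL_times (n1 + n2) (sum_list ns) (S_sharp_block n1 n2) (S_prod ns)"
    using l(1) by simp
  have ne: "S_sharp_block n1 n2 \<noteq> ({} :: 'a mat set)"
    unfolding S_sharp_block_def using vec_carrier by blast
  have pos: "\<forall>m\<in>set ns. 0 < m" using l(5) by auto
  have "has_coords (n + 1) (length (filter (\<lambda>x. k < x) (Suc n1 # ns)))
      (socle_layer (n + 1) (unip_part (S_sharp mu :: 'a mat set)) k)" for k
    using socle_coords_AGL_times[OF S_sharp_block_aff ne S_prod_aff S_prod_ne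
        socle_coords_S_sharp_block[OF n1 l(3,2)] socle_coords_S_prod[OF pos], of k]
    unfolding s S by (simp split: if_splits)
  moreover have "(S_sharp mu :: 'a mat set) \<subseteq> aff_mats n" unfolding S s[symmetric] by (rule AGL_times_aff)
  moreover have "sorted_wrt (\<ge>) (Suc n1 # ns)" using l(2,4) by fastforce
  ultimately have "layer_counts n (Suc n1 # ns) (S_sharp mu :: 'a mat set)"
    unfolding layer_counts_def using pos by auto
  then show ?thesis using that l(1,3) s by blast
qed

theorem theorem6p3:
  fixes n :: nat
  shows "(\<forall>lam1 mu1. partition_type_I (n + 1) lam1 \<and> partition_type_II (n + 1) mu1 \<longrightarrow>
            \<not> conjugate_in (AGL n :: 'a::field mat monoid) (S_std lam1) (S_sharp mu1)) \<and>
         (\<forall>lam1 lam2. partition_type_I (n + 1) lam1 \<and> partition_type_I (n + 1) lam2 \<longrightarrow>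
            (conjugate_in (AGL n :: 'a mat monoid) (S_std lam1) (S_std lam2) \<longleftrightarrow> lam1 = lam2)) \<and>
         (\<forall>mu1 mu2. partition_type_II (n + 1) mu1 \<and> partition_type_II (n + 1) mu2 \<longrightarrow>
            (conjugate_in (AGL n :: 'a mat monoid) (S_sharp mu1) (S_sharp mu2) \<longleftrightarrow> mu1 = mu2))"
proof (intro conjI allI impI notI; elim conjE)
  fix lam mu
  assume I: "partition_type_I (n + 1) lam" and II: "partition_type_II (n + 1) mu"
    and conj: "conjugate_in (AGL n :: 'a mat monoid) (S_std lam) (S_sharp mu)"
  from I obtain n1 ns where l: "sum_list (n1 # ns) = n" "layer_counts n (n1 # ns) (S_std lam :: 'a mat set)"
    by (rule layer_counts_S_std)
  from II obtain m1 m2 ms where m: "1 < m2" "m1 + m2 + sum_list ms = n"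
      "layer_counts n (Suc m1 # ms) (S_sharp mu :: 'a mat set)"
    by (rule layer_counts_S_sharp)
  have "n1 # ns = Suc m1 # ms" by (rule layer_counts_conjugate[OF l(2) m(3) conj])
  \<comment> \<open>The left list sums to \<open>n\<close>, the right one to
    \<open>n + 1 - m2\<close>, which is smaller because \<open>m2 > 1\<close>.\<close>
  then show False using l(1) m(1,2) by auto
next
  fix lam1 lam2
  assume "partition_type_I (n + 1) lam1" "partition_type_I (n + 1) lam2"
  then obtain n1 ns m1 ms where l: "lam1 = Suc n1 # ns" "layer_counts n (n1 # ns) (S_std lam1 :: 'a mat set)"
    and m: "lam2 = Suc m1 # ms" "layer_counts n (m1 # ms) (S_std lam2 :: 'a mat set)"
    using layer_counts_S_std by metis
  show "conjugate_in (AGL n :: 'a mat monoid) (S_std lam1) (S_std lam2) \<longleftrightarrow> lam1 = lam2"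
    using layer_counts_conjugate[OF l(2) m(2)] conjugate_in_AGL_refl[of "S_std lam1" n] l m
    by (auto simp: layer_counts_def)
next
  fix mu1 mu2
  assume "partition_type_II (n + 1) mu1" "partition_type_II (n + 1) mu2"
  then obtain n1 n2 ns m1 m2 ms
    where l: "mu1 = Suc n1 # n2 # ns" "n1 + n2 + sum_list ns = n" "layer_counts n (Suc n1 # ns) (S_sharp mu1 :: 'a mat set)"
      and m: "mu2 = Suc m1 # m2 # ms" "m1 + m2 + sum_list ms = n" "layer_counts n (Suc m1 # ms) (S_sharp mu2 :: 'a mat set)"
    using layer_counts_S_sharp by metis
  have r: "conjugate_in (AGL n) (S_sharp mu1) (S_sharp mu1 :: 'a mat set)"
    using l(3) by (auto simp: layer_counts_def intro: conjugate_in_AGL_refl)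
  \<comment> \<open>Equal lists give \<open>n1 = m1\<close> and \<open>ns = ms\<close>; the two
    sums, both equal to \<open>n\<close>, then force \<open>n2 = m2\<close>.\<close>
  show "conjugate_in (AGL n :: 'a mat monoid) (S_sharp mu1) (S_sharp mu2) \<longleftrightarrow> mu1 = mu2"
    using layer_counts_conjugate[OF l(3) m(3)] r l(1,2) m(1,2) by auto
qed

end
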